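(* Let $d$ be a positive integer and let $S\subseteq\mathbb{N}^{d}$. The following are equivalent: (1) $S$ is a Presburger set; (2) $S$ is a finite union of sets of the form $P\cap(\lambda+\Lambda)$, where $P\subseteq\mathbb{R}^d$ is a rational polyhedron, $\lambda\in\mathbb{Z}^d$, and $\Lambda\subseteq\mathbb{Z}^d$ is a lattice (the data $P,\lambda,\Lambda$ may differ from one set in the union to another); (3) the generating function $f(S;\mathbf{x})$ is a rational generating function.
   Context: Notation: $\mathbb{N}=\{0,1,2,\ldots\}$; bold letters denote vectors; $\mathbf{x}^{\mathbf{s}}=x_1^{s_1}\cdots x_d^{s_d}$. A Presburger formula $F(\mathbf{u})$ with free variables $\mathbf{u}$ is a first-order formula in the language of addition, evaluated over the natural numbers $\mathbb{N}$ (all variables, free and quantified, range over $\mathbb{N}$). Equivalently, it is a Boolean combination of linear equalities and inequalities with integer coefficients and integer constant terms, with some of the variables quantified by $\exists$ or $\forall$ (nested arbitrarily). A set $S\subseteq\mathbb{N}^d$ is a Presburger set if there is a Presburger formula $F(\mathbf{u})$ such that $S=\{\mathbf{u}\in\mathbb{N}^d : F(\mathbf{u})\}$. A rational polyhedron in $\mathbb{R}^d$ is the solution set of a finite system of (non-strict) linear inequalities with rational coefficients and rational constant terms (it may be empty, unbounded, or not full-dimensional). A lattice $\Lambda\subseteq\mathbb{Z}^d$ is an additive subgroup of $\mathbb{Z}^d$ (not necessarily of full rank). The generating function of $S\subseteq\mathbb{N}^d$ is the formal power series $f(S;\mathbf{x})=\sum_{\mathbf{s}\in S}\mathbf{x}^{\mathbf{s}}$.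 A rational generating function is a function that can be written in the form $\dfrac{q(\mathbf{x})}{(1-\mathbf{x}^{\mathbf{b}_1})\cdots(1-\mathbf{x}^{\mathbf{b}_k})}$, where $q(\mathbf{x})\in\mathbb{Q}[\mathbf{x}]$ is a polynomial and $\mathbf{b}_i\in\mathbb{N}^d\setminus\{\mathbf{0}\}$; a power series is said to be a rational generating function if it equals the power series expansion of such an expression (each $1/(1-\mathbf{x}^{\mathbf{b}_i})$ being expanded as $1+\mathbf{x}^{\mathbf{b}_i}+\mathbf{x}^{2\mathbf{b}_i}+\cdots$). *)

theory Defs
  imports "HOL-Analysis.Analysis" "HOL-Library.Poly_Mapping"
begin

section \<open>Presburger sets\<close>

datatype 'v lin_term =
    Const int
  | Var 'v
  | Add "'v lin_term" "'v lin_term"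
  | Scale int "'v lin_term"

primrec lin_val :: "('v \<Rightarrow> nat) \<Rightarrow> 'v lin_term \<Rightarrow> int" where
  "lin_val e (Const c) = c"
| "lin_val e (Var x) = int (e x)"
| "lin_val e (Add s t) = lin_val e s + lin_val e t"
| "lin_val e (Scale c t) = c * lin_val e t"

primrec lin_vars :: "'v lin_term \<Rightarrow> 'v set" where
  "lin_vars (Const c) = {}"
| "lin_vars (Var x) = {x}"
| "lin_vars (Add s t) = lin_vars s \<union> lin_vars t"
| "lin_vars (Scale c t) = lin_vars t"

datatype 'v presburger =
    Eq "'v lin_term" "'v lin_term"
  | Le "'v lin_term" "'v lin_term"
  | Neg "'v presburger"
  | Conj "'v presburger" "'v presburger"
  | Disj "'v presburger" "'v presburger"
  | Exists 'v "'v presburger"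
  | Forall 'v "'v presburger"

primrec sat :: "'v presburger \<Rightarrow> ('v \<Rightarrow> nat) \<Rightarrow> bool" where
  "sat (Eq s t) e \<longleftrightarrow> lin_val e s = lin_val e t"
| "sat (Le s t) e \<longleftrightarrow> lin_val e s \<le> lin_val e t"
| "sat (Neg F) e \<longleftrightarrow> \<not> sat F e"
| "sat (Conj F G) e \<longleftrightarrow> sat F e \<and> sat G e"
| "sat (Disj F G) e \<longleftrightarrow> sat F e \<or> sat G e"
| "sat (Exists x F) e \<longleftrightarrow> (\<exists>n. sat F (e(x := n)))"
| "sat (Forall x F) e \<longleftrightarrow> (\<forall>n. sat F (e(x := n)))"

primrec free_vars :: "'v presburger \<Rightarrow> 'v set" where
  "free_vars (Eq s t) = lin_vars s \<union> lin_vars t"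
| "free_vars (Le s t) = lin_vars s \<union> lin_vars t"
| "free_vars (Neg F) = free_vars F"
| "free_vars (Conj F G) = free_vars F \<union> free_vars G"
| "free_vars (Disj F G) = free_vars F \<union> free_vars G"
| "free_vars (Exists x F) = free_vars F - {x}"
| "free_vars (Forall x F) = free_vars F - {x}"

text \<open>
  The variable \<open>Inl i\<close> stands for the coordinate \<open>u $ i\<close>; the variables \<open>Inr n\<close> are an
  infinite supply of names for quantified variables. They may not occur free, so the
  value \<open>0\<close> assigned to them below is irrelevant.
\<close>

definition presburger_set :: "(nat ^ 'd) set \<Rightarrow> bool" where
  "presburger_set S \<longleftrightarrow>
     (\<exists>F :: ('d + nat) presburger.
        free_vars F \<subseteq> range Inl \<and>
        S = {u. sat F (case_sum (\<lambda>i. u $ i) (\<lambda>_. 0))})"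

section \<open>Polyhedra and lattice cosets\<close>

definition rational_polyhedron :: "(real ^ 'd) set \<Rightarrow> bool" where
  "rational_polyhedron P \<longleftrightarrow>
     (\<exists>A :: ((rat ^ 'd) \<times> rat) set.
        finite A \<and>
        P = {x. \<forall>(a, b)\<in>A. (\<Sum>i\<in>UNIV. of_rat (a $ i) * x $ i) \<le> of_rat b})"

definition int_lattice :: "(int ^ 'd) set \<Rightarrow> bool" where
  "int_lattice L \<longleftrightarrow> 0 \<in> L \<and> (\<forall>x\<in>L. \<forall>y\<in>L. x + y \<in> L) \<and> (\<forall>x\<in>L. - x \<in> L)"

definition real_vec_of_nat :: "nat ^ 'd \<Rightarrow> real ^ 'd" where
  "real_vec_of_nat u = (\<chi> i. real (u $ i))"

definition real_vec_of_int :: "int ^ 'd \<Rightarrow> real ^ 'd" where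
  "real_vec_of_int u = (\<chi> i. real_of_int (u $ i))"

definition polyhedral_lattice_piece :: "(real ^ 'd) set \<Rightarrow> bool" where
  "polyhedral_lattice_piece T \<longleftrightarrow>
     (\<exists>P l L. rational_polyhedron P \<and> int_lattice L \<and>
        T = P \<inter> real_vec_of_int ` ((\<lambda>v. l + v) ` L))"

text \<open>
  The pieces are subsets of \<open>\<real>\<^sup>d\<close>, so \<open>S\<close> is compared with their union through its image there;
  in particular every piece is contained in the image of \<open>\<nat>\<^sup>d\<close>.
\<close>

definition finite_union_of_pieces :: "(nat ^ 'd) set \<Rightarrow> bool" where
  "finite_union_of_pieces S \<longleftrightarrow>
     (\<exists>\<T>. finite \<T> \<and> (\<forall>T\<in>\<T>. polyhedral_lattice_piece T) \<and> real_vec_of_nat ` S = \<Union>\<T>)"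

section \<open>Multivariate formal power series\<close>

text \<open>
  A series is its family of coefficients, indexed by exponent vectors.
\<close>

typedef (overloaded) ('a, 'd) mfps = "UNIV :: (nat ^ 'd \<Rightarrow> 'a) set"
  morphisms mfps_nth Abs_mfps ..

setup_lifting type_definition_mfps

lemma mfps_eq_iff: "f = g \<longleftrightarrow> (\<forall>n. mfps_nth f n = mfps_nth g n)"
  by transfer auto

lemma finite_exponent_le: "finite {u :: nat ^ 'd::finite. \<forall>i. u $ i \<le> n $ i}"
proof -
  have "{u :: nat ^ 'd. \<forall>i. u $ i \<le> n $ i} \<subseteq> vec_lambda ` (\<Pi>\<^sub>E i\<in>UNIV. {..n $ i})"
  proof
    fix u :: "nat ^ 'd" assume "u \<in> {u. \<forall>i. u $ i \<le> n $ i}"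
    then have "vec_nth u \<in> (\<Pi>\<^sub>E i\<in>UNIV. {..n $ i})" by auto
    then show "u \<in> vec_lambda ` (\<Pi>\<^sub>E i\<in>UNIV. {..n $ i})"
      by (metis image_eqI vec_lambda_eta)
  qed
  then show ?thesis
    by (rule finite_subset) (intro finite_imageI finite_PiE, auto)
qed

lemma finite_exponent_splits: "finite {(a, b). a + b = (n :: nat ^ 'd::finite)}"
  by (rule finite_subset[of _ "{u. \<forall>i. u $ i \<le> n $ i} \<times> {u. \<forall>i. u $ i \<le> n $ i}"])
     (auto intro: finite_exponent_le)

instantiation mfps :: (comm_ring_1, finite) comm_ring_1
begin

lift_definition zero_mfps :: "('a, 'b) mfps" is "\<lambda>_. 0" .

lift_definition one_mfps :: "('a, 'b) mfps" is "\<lambda>n. if n = 0 then 1 else 0" .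

lift_definition plus_mfps :: "('a, 'b) mfps \<Rightarrow> ('a, 'b) mfps \<Rightarrow> ('a, 'b) mfps"
  is "\<lambda>f g n. f n + g n" .

lift_definition minus_mfps :: "('a, 'b) mfps \<Rightarrow> ('a, 'b) mfps \<Rightarrow> ('a, 'b) mfps"
  is "\<lambda>f g n. f n - g n" .

lift_definition uminus_mfps :: "('a, 'b) mfps \<Rightarrow> ('a, 'b) mfps"
  is "\<lambda>f n. - f n" .

lift_definition times_mfps :: "('a, 'b) mfps \<Rightarrow> ('a, 'b) mfps \<Rightarrow> ('a, 'b) mfps"
  is "\<lambda>f g n. \<Sum>(a, b)\<in>{(a, b). a + b = n}. f a * g b" .

instance
proof
  fix f g h :: "('a, 'b) mfps"
  show "f * g * h = f * (g * h)"
  proof (transfer, rule ext)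
    fix f g h :: "nat ^ 'b \<Rightarrow> 'a" and n
    let ?D = "\<lambda>n :: nat ^ 'b. {(a, b). a + b = n}"
    have fin: "finite (?D m)" for m by (rule finite_exponent_splits)
    have "(\<Sum>(a, b)\<in>?D n. (\<Sum>(a, b)\<in>?D a. f a * g b) * h b) =
        (\<Sum>p\<in>?D n. \<Sum>q\<in>?D (fst p). f (fst q) * g (snd q) * h (snd p))"
      by (simp add: sum_distrib_right case_prod_beta)
    also have "\<dots> = (\<Sum>(p, q)\<in>(SIGMA p:?D n. ?D (fst p)). f (fst q) * g (snd q) * h (snd p))"
      using fin by (subst sum.Sigma) auto
    also have "\<dots> = (\<Sum>(p, q)\<in>(SIGMA p:?D n. ?D (snd p)). f (fst p) * (g (fst q) * h (snd q)))"
      by (rule sum.reindex_bij_witness[where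
            i = "\<lambda>(p, q). ((fst p + fst q, snd q), (fst p, fst q))" and
            j = "\<lambda>(p, q). ((fst q, snd q + snd p), (snd q, snd p))"])
         (auto simp: add.assoc mult.assoc)
    also have "\<dots> = (\<Sum>p\<in>?D n. \<Sum>q\<in>?D (snd p). f (fst p) * (g (fst q) * h (snd q)))"
      using fin by (subst sum.Sigma) auto
    also have "\<dots> = (\<Sum>(a, b)\<in>?D n. f a * (\<Sum>(a, b)\<in>?D b. g a * h b))"
      by (simp add: sum_distrib_left case_prod_beta)
    finally show "(\<Sum>(a, b)\<in>?D n. (\<Sum>(a, b)\<in>?D a. f a * g b) * h b) =
        (\<Sum>(a, b)\<in>?D n. f a * (\<Sum>(a, b)\<in>?D b. g a * h b))" .
  qed
  show "f * g = g * f"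
  proof (transfer, rule ext)
    fix f g :: "nat ^ 'b \<Rightarrow> 'a" and n
    show "(\<Sum>(a, b)\<in>{(a, b). a + b = n}. f a * g b) = (\<Sum>(a, b)\<in>{(a, b). a + b = n}. g a * f b)"
      by (rule sum.reindex_bij_witness[where i = prod.swap and j = prod.swap])
         (auto simp: add.commute mult.commute)
  qed
  show "1 * f = f"
  proof (transfer, rule ext)
    fix f :: "nat ^ 'b \<Rightarrow> 'a" and n
    have "(\<Sum>(a, b)\<in>{(a, b). a + b = n}. (if a = 0 then 1 else 0) * f b) =
        (\<Sum>(a, b)\<in>{(0 :: nat ^ 'b, n)}. (if a = 0 then 1 else 0) * f b)"
      by (rule sum.mono_neutral_right) (auto simp: finite_exponent_splits split: if_splits)
    then show "(\<Sum>(a, b)\<in>{(a, b). a + b = n}. (if a = 0 then 1 else 0) * f b) = f n"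
      by simp
  qed
  show "(f + g) * h = f * h + g * h"
    by transfer (simp add: algebra_simps case_prod_beta sum.distrib)
  show "(0 :: ('a, 'b) mfps) \<noteq> 1"
    by transfer (metis one_neq_zero)
qed (transfer; simp add: fun_eq_iff algebra_simps)+

end

text \<open>
  Polynomials are finitely supported maps from exponent vectors to coefficients.
\<close>

lift_definition mfps_of_poly :: "((nat ^ 'd) \<Rightarrow>\<^sub>0 'a::zero) \<Rightarrow> ('a, 'd) mfps"
  is "\<lambda>q. q" .

text \<open>
  The series \<open>1 + x\<^sup>b + x\<^sup>2\<^sup>b + \<dots>\<close>, with \<open>b \<noteq> 0\<close> in all uses.
\<close>

lift_definition mfps_geometric :: "nat ^ 'd \<Rightarrow> ('a::zero_neq_one, 'd) mfps"
  is "\<lambda>b n. if \<exists>k. n = k *s b then 1 else 0" .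

lemma mfps_geometric_inverse:
  fixes b :: "nat ^ 'd::finite"
  assumes "b \<noteq> 0"
  shows "(1 - mfps_of_poly (Poly_Mapping.single b 1)) * mfps_geometric b =
    (1 :: ('a::comm_ring_1, 'd) mfps)"
proof -
  have "mfps_nth (mfps_of_poly (Poly_Mapping.single b 1) * mfps_geometric b) n =
    mfps_nth (mfps_geometric b - (1 :: ('a, 'd) mfps)) n" for n
  proof -
    let ?D = "{(a, c). a + c = n}"
    let ?g = "\<lambda>n. if \<exists>k. n = k *s b then 1 else (0 :: 'a)"
    have step: "b + k *s b = Suc k *s b" for k
      by (simp add: vec_eq_iff)
    have split: "n = 0 \<or> (\<exists>k. n = Suc k *s b)" if "n = k *s b" for k
      using that by (cases k) auto
    have nz: "Suc k *s b \<noteq> 0" for k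
      using assms by (auto simp: vec_eq_iff)
    have "mfps_nth (mfps_of_poly (Poly_Mapping.single b 1) * mfps_geometric b) n =
        (\<Sum>(a, c)\<in>?D. Poly_Mapping.lookup (Poly_Mapping.single b 1) a * ?g c)"
      by transfer simp
    also have "\<dots> = (\<Sum>(a, c)\<in>?D \<inter> {b} \<times> UNIV. ?g c)"
      by (rule sum.mono_neutral_cong_right)
         (auto simp: finite_exponent_splits lookup_single when_def split: if_splits)
    also have "\<dots> = (if \<exists>k. n = Suc k *s b then 1 else 0)"
    proof (cases "\<exists>c. b + c = n")
      case True
      then obtain c where c: "b + c = n" by blast
      then have "?D \<inter> {b} \<times> UNIV = {(b, c)}" by auto
      moreover have "(\<exists>k. c = k *s b) \<longleftrightarrow> (\<exists>k. n = Suc k *s b)"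
        using c by (metis step add_left_imp_eq)
      ultimately show ?thesis by simp
    next
      case False
      then have "?D \<inter> {b} \<times> UNIV = {}" by auto
      moreover have "\<nexists>k. n = Suc k *s b" using False by (metis step)
      ultimately show ?thesis by simp
    qed
    also have "\<dots> = ?g n - (if n = 0 then 1 else 0)"
    proof (cases "n = 0")
      case True
      have "n = 0 *s b" using True by (simp add: vec_eq_iff)
      then have "\<exists>k. n = k *s b" by blast
      moreover have "\<nexists>k. n = Suc k *s b" using nz True by metis
      ultimately show ?thesis using True by simp
    next
      case False
      then have "(\<exists>k. n = k *s b) \<longleftrightarrow> (\<exists>k. n = Suc k *s b)"
        using split by blast
      then show ?thesis using False by simp
    qed
    also have "\<dots> = mfps_nth (mfps_geometric b - (1 :: ('a, 'd) mfps)) n"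
      by transfer simp
    finally show ?thesis .
  qed
  then have "mfps_of_poly (Poly_Mapping.single b 1) * mfps_geometric b =
    mfps_geometric b - (1 :: ('a, 'd) mfps)"
    by (simp add: mfps_eq_iff)
  then show ?thesis by (simp add: algebra_simps)
qed

lift_definition generating_function :: "(nat ^ 'd) set \<Rightarrow> (rat, 'd) mfps"
  is "\<lambda>S s. if s \<in> S then 1 else 0" .

definition rational_gf :: "(rat, 'd::finite) mfps \<Rightarrow> bool" where
  "rational_gf f \<longleftrightarrow>
     (\<exists>(q :: (nat ^ 'd) \<Rightarrow>\<^sub>0 rat) (bs :: (nat ^ 'd) list).
        0 \<notin> set bs \<and> f = mfps_of_poly q * (\<Prod>b\<leftarrow>bs. mfps_geometric b))"

end

theory Submission
  imports
    "HOL-Decision_Procs.Cooper"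
    "HOL-Computational_Algebra.Polynomial"
    Defs
begin

hide_const (open) Cooper.T Cooper.F Cooper.E Cooper.A Cooper.C

text \<open>
  Cooper's quantifier elimination turns a Presburger set into a Boolean combination of integer
  half-spaces and congruences (\<open>presburger_imp_qf_set\<close>). In disjunctive normal form such a
  combination is a finite union of intersections of a polyhedron with a lattice coset, and
  conversely these intersections are definable because denominators can be cleared and a
  subgroup of \<open>\<int>\<^sup>d\<close> is finitely generated. This settles the first equivalence.

  For the second one the key notion is a \<^emph>\<open>free linear set\<close> \<open>c + \<nat> b\<^sub>1 + \<dots> + \<nat> b\<^sub>k\<close>, in which
  every point has exactly one vector of coefficients. Its generating function is
  \<open>x\<^sup>c / ((1 - x\<^sup>b\<^sup>1) \<dots> (1 - x\<^sup>b\<^sup>k))\<close>. Every half-space and every congruence cuts a free linear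
  set into finitely many disjoint free linear sets (\<open>qf_set_splits\<close>). For a congruence modulo
  \<open>m\<close> all generators are multiplied by \<open>m\<close>. For a half-space the generators are first rescaled
  so that the linear form takes only the values \<open>-D\<close>, \<open>0\<close>, \<open>D\<close> on them; then a generator of
  value \<open>D\<close> and one of value \<open>-D\<close> are combined into one of value \<open>0\<close>, as in Elliott's
  algorithm. Hence a Presburger set is a finite disjoint union of free linear sets, and its
  generating function is rational.

  Conversely, let the generating function of \<open>S\<close> be rational. Relations between the exponents
  in a denominator can be used to rewrite the fraction as a sum of monomials divided by products
  of \<open>1 - x\<^sup>b\<close> in which the distinct \<open>b\<close> are independent (\<open>rational_gf_imp_fraction_sum\<close>). The
  coefficients of one such summand vanish outside a free linear set and are given there by a
  product of binomial coefficients, hence by a polynomial in the coordinates. The supports are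
  Presburger, so \<open>\<nat>\<^sup>d\<close> is partitioned into finitely many free linear pieces each of which lies
  inside or outside of every support. Along a ray in such a piece the coefficient of the
  generating function is then a polynomial in one variable all of whose values are \<open>0\<close> or \<open>1\<close>,
  and such a polynomial is constant. So every piece lies in \<open>S\<close> or in its complement, and \<open>S\<close>
  is a finite union of free linear sets, which are clearly Presburger.
\<close>

section \<open>Quantifier elimination\<close>

definition affine_form :: "int ^ 'd \<Rightarrow> int \<Rightarrow> nat ^ 'd \<Rightarrow> int" where
  "affine_form a c u = c + (\<Sum>i\<in>UNIV. a $ i * int (u $ i))"

text \<open>
  Quantifier-free definability. The congruences are indispensable: projecting \<open>u = 2 v\<close> to \<open>u\<close>
  gives the even numbers, which no Boolean combination of half-spaces describes.
\<close>

inductive qf_set :: "(nat ^ 'd) set \<Rightarrow> bool" where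
  halfspace: "qf_set {u. 0 \<le> affine_form a c u}"
| congruence: "m > 0 \<Longrightarrow> qf_set {u. m dvd affine_form a c u}"
| compl: "qf_set S \<Longrightarrow> qf_set (- S)"
| inter: "qf_set S \<Longrightarrow> qf_set T \<Longrightarrow> qf_set (S \<inter> T)"

lemma affine_form_scale: "k * affine_form a c u = affine_form (k *s a) (k * c) u"
  by (simp add: affine_form_def sum_distrib_left algebra_simps)

lemma affine_form_add: "affine_form a c u + affine_form a' c' u = affine_form (a + a') (c + c') u"
  by (simp add: affine_form_def sum.distrib algebra_simps)

lemma affine_form_uminus: "- affine_form a c u = affine_form (- a) (- c) u"
  by (simp add: affine_form_def sum_negf)

lemma affine_form_add_const: "k + affine_form a c u = affine_form a (k + c) u"
  by (simp add: affine_form_def)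

lemma qf_set_union:
  assumes "qf_set S" "qf_set T" shows "qf_set (S \<union> T)"
proof -
  have "qf_set (- (- S \<inter> - T))" using assms by (intro qf_set.intros)
  then show ?thesis by (simp add: Un_def Compl_eq)
qed

lemma qf_set_UNIV: "qf_set UNIV"
proof -
  have "qf_set ({u. 0 \<le> affine_form 0 0 u} :: (nat ^ 'a) set)" by (rule qf_set.intros)
  then show ?thesis by (simp add: affine_form_def)
qed

lemma qf_set_empty: "qf_set {}"
  using qf_set.compl[OF qf_set_UNIV] by simp

lemma qf_set_zero: "qf_set {u. affine_form a c u = 0}"
proof -
  have "qf_set ({u. 0 \<le> affine_form a c u} \<inter> {u. 0 \<le> affine_form (- a) (- c) u})"
    by (intro qf_set.intros)
  then show ?thesis
    by (simp add: affine_form_uminus[symmetric] Int_def order_antisym_conv eq_iff conj_commute)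
qed

lemma qf_set_dvd: "qf_set {u. m dvd affine_form a c u}"
proof (cases "m = 0")
  case True
  then show ?thesis using qf_set_zero by simp
next
  case False
  then have "qf_set {u. \<bar>m\<bar> dvd affine_form a c u}" by (intro qf_set.congruence) simp
  then show ?thesis by simp
qed

text \<open>
  Terms of Cooper's language may contain variables without a value in the environment. For a
  fixed length of the environment their value is a fixed unspecified number, so it can serve as
  the constant term of an affine form and no bound on the variables has to be tracked.
\<close>

lemma nth_beyond_length:
  assumes "length xs = length ys" "length xs \<le> n"
  shows "xs ! n = ys ! n"
  using assms by (induction xs ys arbitrary: n rule: list_induct2) (auto simp: nth_Cons')

lemma env_nth_affine:
  fixes g :: "nat \<Rightarrow> 'd::finite"
  shows "\<exists>a c. \<forall>u. map (\<lambda>k. int (u $ g k)) [0..<N] ! n = affine_form a c u"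
proof (cases "n < N")
  case True
  then have "map (\<lambda>k. int (u $ g k)) [0..<N] ! n = affine_form (axis (g n) 1) 0 u" for u
    by (simp add: affine_form_def axis_def if_distrib[of "\<lambda>x. x * _"] cong: if_cong)
  then show ?thesis by blast
next
  case False
  have "map (\<lambda>k. int (u $ g k)) [0..<N] ! n
      = affine_form 0 (map (\<lambda>k. int ((0 :: nat ^ 'd) $ g k)) [0..<N] ! n) u" for u
    unfolding affine_form_def
    using False nth_beyond_length[of "map (\<lambda>k. int (u $ g k)) [0..<N]"
        "map (\<lambda>k. int ((0 :: nat ^ 'd) $ g k)) [0..<N]" n]
    by simp
  then show ?thesis by blast
qed

lemma Inum_affine:
  fixes g :: "nat \<Rightarrow> 'd::finite"
  shows "\<exists>a c. \<forall>u. Inum (map (\<lambda>k. int (u $ g k)) [0..<N]) t = affine_form a c u"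
proof (induction t)
  case (C k)
  have "Inum (map (\<lambda>k. int (u $ g k)) [0..<N]) (num.C k) = affine_form 0 k u" for u
    by (simp add: affine_form_def)
  then show ?case by blast
next
  case (Bound n)
  then show ?case using env_nth_affine by simp
next
  case (CN n k t)
  then obtain a c where t: "\<And>u. Inum (map (\<lambda>k. int (u $ g k)) [0..<N]) t = affine_form a c u"
    by blast
  obtain a' c' where x: "\<And>u. map (\<lambda>k. int (u $ g k)) [0..<N] ! n = affine_form a' c' u"
    using env_nth_affine by blast
  show ?case unfolding Inum.simps t x affine_form_scale affine_form_add by blast
next
  case (Neg t)
  then show ?case by (metis Inum.simps(4) affine_form_uminus)
next
  case (Add s t)
  then show ?case by (metis Inum.simps(5) affine_form_add)
next
  case (Sub s t)
  then show ?case by (metis Inum.simps(6) affine_form_add affine_form_uminus diff_conv_add_uminus)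
next
  case (Mul k t)
  then show ?case by (metis Inum.simps(7) affine_form_scale)
qed

lemma qf_set_qfree:
  fixes g :: "nat \<Rightarrow> 'd::finite"
  assumes "qfree p"
  shows "qf_set {u. Ifm bbs (map (\<lambda>k. int (u $ g k)) [0..<N]) p}"
proof -
  let ?e = "\<lambda>u. map (\<lambda>k. int (u $ g k)) [0..<N]"
  note aff = Inum_affine[of g N]
  have half: "qf_set {u. 0 \<le> k + j * Inum (?e u) t}" for t k j
  proof -
    obtain a c where "\<And>u. Inum (?e u) t = affine_form a c u" using aff by blast
    then show ?thesis by (simp add: affine_form_scale affine_form_add_const qf_set.halfspace)
  qed
  have dvd: "qf_set {u. m dvd Inum (?e u) t}" for m t
  proof -
    obtain a c where "\<And>u. Inum (?e u) t = affine_form a c u" using aff by blast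
    then show ?thesis by (simp add: qf_set_dvd)
  qed
  have neg: "qf_set {u. \<not> P u}" if "qf_set {u. P u}" for P :: "nat ^ 'd \<Rightarrow> bool"
    using qf_set.compl[OF that] by (simp add: Compl_eq)
  have conj: "qf_set {u. P u \<and> Q u}" if "qf_set {u. P u}" "qf_set {u. Q u}" for P Q :: "nat ^ 'd \<Rightarrow> bool"
    using qf_set.inter[OF that] by (simp add: Int_def)
  have disj: "qf_set {u. P u \<or> Q u}" if "qf_set {u. P u}" "qf_set {u. Q u}" for P Q :: "nat ^ 'd \<Rightarrow> bool"
    using qf_set_union[OF that] by (simp add: Un_def)
  show ?thesis using assms
  proof (induction p)
    case (Lt t)
    have "x < 0 \<longleftrightarrow> 0 \<le> - 1 + - 1 * x" for x :: int by linarith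
    then have "{u. Ifm bbs (?e u) (fm.Lt t)} = {u. 0 \<le> - 1 + - 1 * Inum (?e u) t}"
      unfolding Ifm.simps by blast
    then show ?case using half[of "- 1" "- 1" t] by (simp only:)
  next
    case (Le t)
    show ?case using half[of 0 "-1" t] by simp
  next
    case (Gt t)
    show ?case using half[of "-1" 1 t] by (simp add: int_one_le_iff_zero_less)
  next
    case (Ge t)
    show ?case using half[of 0 1 t] by simp
  next
    case (Eq t)
    show ?case using dvd[of 0 t] by simp
  next
    case (NEq t)
    show ?case using neg[OF dvd[of 0 t]] by simp
  next
    case (Not p)
    show ?case unfolding Ifm.simps by (rule neg[OF Not.IH]) (use Not.prems in simp)
  next
    case (And p q)
    show ?case unfolding Ifm.simps by (rule conj[OF And.IH]) (use And.prems in simp_all)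
  next
    case (Or p q)
    show ?case unfolding Ifm.simps by (rule disj[OF Or.IH]) (use Or.prems in simp_all)
  next
    case (Imp p q)
    have "qf_set {u. \<not> Ifm bbs (?e u) p \<or> Ifm bbs (?e u) q}"
      by (rule disj[OF neg[OF Imp.IH(1)] Imp.IH(2)]) (use Imp.prems in simp_all)
    then show ?case unfolding Ifm.simps imp_conv_disj .
  next
    case (Iff p q)
    have "qf_set {u. (\<not> Ifm bbs (?e u) p \<or> Ifm bbs (?e u) q) \<and>
        (\<not> Ifm bbs (?e u) q \<or> Ifm bbs (?e u) p)}"
      by (rule conj[OF disj[OF neg[OF Iff.IH(1)] Iff.IH(2)] disj[OF neg[OF Iff.IH(2)] Iff.IH(1)]])
        (use Iff.prems in simp_all)
    moreover have "{u. Ifm bbs (?e u) (fm.Iff p q)} = {u. (\<not> Ifm bbs (?e u) p \<or> Ifm bbs (?e u) q) \<and>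
        (\<not> Ifm bbs (?e u) q \<or> Ifm bbs (?e u) p)}" by auto
    ultimately show ?case by simp
  next
    case (Dvd m t)
    then show ?case unfolding Ifm.simps by (intro dvd)
  next
    case (NDvd m t)
    then show ?case unfolding Ifm.simps by (intro neg dvd)
  qed (simp_all add: qf_set_UNIV qf_set_empty)
qed

primrec cooper_num :: "('v \<Rightarrow> nat) \<Rightarrow> 'v lin_term \<Rightarrow> num" where
  "cooper_num \<rho> (Const c) = num.C c"
| "cooper_num \<rho> (Var x) = num.Bound (\<rho> x)"
| "cooper_num \<rho> (Add s t) = num.Add (cooper_num \<rho> s) (cooper_num \<rho> t)"
| "cooper_num \<rho> (Scale c t) = num.Mul c (cooper_num \<rho> t)"

text \<open>
  The map \<open>\<rho>\<close> sends a variable to its de Bruijn index. Quantifiers range over \<open>\<int>\<close> in the target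
  language and are therefore relativised to the non-negative integers.
\<close>

primrec cooper_fm :: "'v presburger \<Rightarrow> ('v \<Rightarrow> nat) \<Rightarrow> fm" where
  "cooper_fm (Eq s t) \<rho> = fm.Eq (num.Sub (cooper_num \<rho> s) (cooper_num \<rho> t))"
| "cooper_fm (Le s t) \<rho> = fm.Le (num.Sub (cooper_num \<rho> s) (cooper_num \<rho> t))"
| "cooper_fm (Neg F) \<rho> = fm.Not (cooper_fm F \<rho>)"
| "cooper_fm (Conj F G) \<rho> = fm.And (cooper_fm F \<rho>) (cooper_fm G \<rho>)"
| "cooper_fm (Disj F G) \<rho> = fm.Or (cooper_fm F \<rho>) (cooper_fm G \<rho>)"
| "cooper_fm (Exists x F) \<rho> =
     fm.E (fm.And (fm.Ge (num.Bound 0)) (cooper_fm F (\<lambda>y. if y = x then 0 else Suc (\<rho> y))))"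
| "cooper_fm (Forall x F) \<rho> =
     fm.A (fm.Imp (fm.Ge (num.Bound 0)) (cooper_fm F (\<lambda>y. if y = x then 0 else Suc (\<rho> y))))"

lemma Inum_cooper_num:
  assumes "\<And>x. x \<in> lin_vars t \<Longrightarrow> bs ! \<rho> x = int (e x)"
  shows "Inum bs (cooper_num \<rho> t) = lin_val e t"
  using assms by (induction t) auto

lemma Ifm_cooper_fm:
  assumes "\<And>x. x \<in> free_vars F \<Longrightarrow> bs ! \<rho> x = int (e x)"
  shows "Ifm bbs bs (cooper_fm F \<rho>) \<longleftrightarrow> sat F e"
  using assms
proof (induction F arbitrary: bs \<rho> e)
  case (Eq s t)
  then show ?case using Inum_cooper_num[of s bs \<rho> e] Inum_cooper_num[of t bs \<rho> e] by simp
next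
  case (Le s t)
  then show ?case using Inum_cooper_num[of s bs \<rho> e] Inum_cooper_num[of t bs \<rho> e] by simp
next
  case (Exists x F)
  have "Ifm bbs (int n # bs) (cooper_fm F (\<lambda>y. if y = x then 0 else Suc (\<rho> y))) \<longleftrightarrow> sat F (e(x := n))" for n
    by (rule Exists.IH) (use Exists.prems in auto)
  then show ?case by simp (metis int_nat_eq of_nat_0_le_iff)
next
  case (Forall x F)
  have "Ifm bbs (int n # bs) (cooper_fm F (\<lambda>y. if y = x then 0 else Suc (\<rho> y))) \<longleftrightarrow> sat F (e(x := n))" for n
    by (rule Forall.IH) (use Forall.prems in auto)
  then show ?case by simp (metis int_nat_eq of_nat_0_le_iff)
next
  case (Conj F G)
  then show ?case by (metis Ifm.simps(12) Un_iff cooper_fm.simps(4) free_vars.simps(4) sat.simps(4))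
next
  case (Disj F G)
  then show ?case by (metis Ifm.simps(13) Un_iff cooper_fm.simps(5) free_vars.simps(5) sat.simps(5))
next
  case (Neg F)
  then show ?case by simp
qed

theorem presburger_imp_qf_set:
  fixes S :: "(nat ^ 'd::finite) set"
  assumes "presburger_set S"
  shows "qf_set S"
proof -
  obtain F :: "('d + nat) presburger" where F: "free_vars F \<subseteq> range Inl"
    and S: "S = {u. sat F (case_sum (\<lambda>i. u $ i) (\<lambda>_. 0))}"
    using assms unfolding presburger_set_def by blast
  obtain g where g: "bij_betw g {0..<CARD('d)} (UNIV :: 'd set)"
    using ex_bij_betw_nat_finite[of "UNIV :: 'd set", OF finite] by blast
  define h where "h = inv_into {0..<CARD('d)} g"
  have h: "h i < CARD('d)" "g (h i) = i" for i
  proof -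
    have "i \<in> g ` {0..<CARD('d)}" using g by (simp add: bij_betw_def)
    from inv_into_into[OF this] f_inv_into_f[OF this]
    show "h i < CARD('d)" "g (h i) = i" by (simp_all add: h_def)
  qed
  let ?p = "cooper_fm F (case_sum h (\<lambda>_. 0))"
  have "Ifm [] (map (\<lambda>k. int (u $ g k)) [0..<CARD('d)]) (pa ?p) \<longleftrightarrow>
      sat F (case_sum (\<lambda>i. u $ i) (\<lambda>_. 0))" for u
    unfolding conjunct1[OF mirqe] by (rule Ifm_cooper_fm) (use F h in auto)
  then have "S = {u. Ifm [] (map (\<lambda>k. int (u $ g k)) [0..<CARD('d)]) (pa ?p)}" by (simp only: S)
  moreover have "qf_set {u. Ifm [] (map (\<lambda>k. int (u $ g k)) [0..<CARD('d)]) (pa ?p)}"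
    by (rule qf_set_qfree) (simp only: mirqe)
  ultimately show ?thesis by (simp only:)
qed

section \<open>Building Presburger sets\<close>

abbreviation (input) coord_env :: "nat ^ 'd \<Rightarrow> 'd + nat \<Rightarrow> nat" where
  "coord_env u \<equiv> case_sum (\<lambda>i. u $ i) (\<lambda>_. 0)"

lemma presburger_set_Compl:
  assumes "presburger_set S" shows "presburger_set (- S)"
proof -
  obtain F where F: "free_vars F \<subseteq> range Inl" "S = {u. sat F (coord_env u)}"
    using assms unfolding presburger_set_def by blast
  then show ?thesis unfolding presburger_set_def by (intro exI[of _ "Neg F"]) auto
qed

lemma presburger_set_Int:
  assumes "presburger_set S" "presburger_set T" shows "presburger_set (S \<inter> T)"
proof -
  obtain F G where "free_vars F \<subseteq> range Inl" "S = {u. sat F (coord_env u)}"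
    "free_vars G \<subseteq> range Inl" "T = {u. sat G (coord_env u)}"
    using assms unfolding presburger_set_def by blast
  then show ?thesis unfolding presburger_set_def by (intro exI[of _ "Conj F G"]) auto
qed

lemma presburger_set_Un:
  assumes "presburger_set S" "presburger_set T" shows "presburger_set (S \<union> T)"
proof -
  have "S \<union> T = - (- S \<inter> - T)" by auto
  then show ?thesis using assms by (metis presburger_set_Compl presburger_set_Int)
qed

lemma presburger_set_empty: "presburger_set {}"
  unfolding presburger_set_def by (intro exI[of _ "Eq (Const 0) (Const 1)"]) auto

lemma presburger_set_Union:
  assumes "finite \<S>" "\<And>S. S \<in> \<S> \<Longrightarrow> presburger_set S" shows "presburger_set (\<Union>\<S>)"
  using assms by (induction \<S>) (auto simp: presburger_set_empty presburger_set_Un)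

lemma presburger_set_Inter:
  assumes "finite \<S>" "\<And>S. S \<in> \<S> \<Longrightarrow> presburger_set S" shows "presburger_set (\<Inter>\<S>)"
proof -
  have "\<Inter>\<S> = - \<Union> (uminus ` \<S>)" by auto
  moreover have "presburger_set (\<Union> (uminus ` \<S>))"
    by (rule presburger_set_Union) (use assms presburger_set_Compl in auto)
  ultimately show ?thesis by (simp only: presburger_set_Compl)
qed

lemma ex_lin_term:
  assumes "finite V"
  shows "\<exists>t. lin_vars t \<subseteq> V \<and> (\<forall>e. lin_val e t = c + (\<Sum>v\<in>V. a v * int (e v)))"
  using assms
proof (induction V)
  case empty
  then show ?case by (intro exI[of _ "Const c"]) auto
next
  case (insert x V)
  then obtain t where "lin_vars t \<subseteq> V" "\<And>e. lin_val e t = c + (\<Sum>v\<in>V. a v * int (e v))" by blast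
  then show ?case using insert by (intro exI[of _ "Add (Scale (a x) (Var x)) t"]) auto
qed

lemma ex_conj_formula:
  assumes "finite I" "\<And>i. i \<in> I \<Longrightarrow> \<exists>F. free_vars F \<subseteq> V \<and> (\<forall>e. sat F e \<longleftrightarrow> P i e)"
  shows "\<exists>F. free_vars F \<subseteq> V \<and> (\<forall>e. sat F e \<longleftrightarrow> (\<forall>i\<in>I. P i e))"
  using assms
proof (induction I)
  case empty
  then show ?case by (intro exI[of _ "Eq (Const 0) (Const 0)"]) auto
next
  case (insert x I)
  obtain F where "free_vars F \<subseteq> V" "\<And>e. sat F e \<longleftrightarrow> (\<forall>i\<in>I. P i e)"
    using insert.IH insert.prems by auto
  moreover obtain G where "free_vars G \<subseteq> V" "\<And>e. sat G e \<longleftrightarrow> P x e"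
    using insert.prems[of x] by auto
  ultimately show ?case by (intro exI[of _ "Conj G F"]) auto
qed

lemma ex_exists_formula:
  assumes "finite X"
  shows "\<exists>G. free_vars G = free_vars F - X \<and>
    (\<forall>e. sat G e \<longleftrightarrow> (\<exists>n. sat F (\<lambda>v. if v \<in> X then n v else e v)))"
  using assms
proof (induction X)
  case empty
  then show ?case by (intro exI[of _ F]) auto
next
  case (insert x X)
  then obtain G where G: "free_vars G = free_vars F - X"
    "\<And>e. sat G e \<longleftrightarrow> (\<exists>n. sat F (\<lambda>v. if v \<in> X then n v else e v))" by blast
  have "(\<exists>k n. sat F (\<lambda>v. if v \<in> X then n v else (e(x := k)) v)) \<longleftrightarrow>
      (\<exists>n. sat F (\<lambda>v. if v \<in> insert x X then n v else e v))" for e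
  proof
    assume "\<exists>k n. sat F (\<lambda>v. if v \<in> X then n v else (e(x := k)) v)"
    then obtain k n where "sat F (\<lambda>v. if v \<in> X then n v else (e(x := k)) v)" by blast
    moreover have "(\<lambda>v. if v \<in> X then n v else (e(x := k)) v) =
        (\<lambda>v. if v \<in> insert x X then (n(x := k)) v else e v)" using insert.hyps by auto
    ultimately show "\<exists>n. sat F (\<lambda>v. if v \<in> insert x X then n v else e v)" by metis
  next
    assume "\<exists>n. sat F (\<lambda>v. if v \<in> insert x X then n v else e v)"
    then obtain n where "sat F (\<lambda>v. if v \<in> insert x X then n v else e v)" by blast
    moreover have "(\<lambda>v. if v \<in> insert x X then n v else e v) =
        (\<lambda>v. if v \<in> X then n v else (e(x := n x)) v)" by auto
    ultimately show "\<exists>k n. sat F (\<lambda>v. if v \<in> X then n v else (e(x := k)) v)" by metis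
  qed
  then show ?case using G by (intro exI[of _ "Exists x G"]) auto
qed

lemma presburger_set_halfspace:
  "presburger_set ({u. 0 \<le> affine_form a c u} :: (nat ^ 'd::finite) set)"
proof -
  obtain t :: "('d + nat) lin_term" where t: "lin_vars t \<subseteq> range Inl"
    "\<And>e. lin_val e t = c + (\<Sum>v\<in>range Inl. case_sum (vec_nth a) (\<lambda>_. 0) v * int (e v))"
    using ex_lin_term[OF finite_imageI[OF finite], of Inl UNIV c "case_sum (vec_nth a) (\<lambda>_. 0)"] by blast
  have "lin_val (coord_env u) t = affine_form a c u" for u
    by (simp add: t affine_form_def sum.reindex)
  then show ?thesis using t(1)
    unfolding presburger_set_def by (intro exI[of _ "Le (Const 0) t"]) auto
qed

text \<open>
  The coefficients \<open>n j\<close> become existentially quantified variables. The generators may have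
  negative entries, as needed for lattices.
\<close>

lemma presburger_set_linear_image:
  fixes c :: "int ^ 'd::finite" and b :: "'i \<Rightarrow> int ^ 'd"
  assumes "finite J"
  shows "presburger_set {u. \<exists>n. \<forall>i. int (u $ i) = c $ i + (\<Sum>j\<in>J. b j $ i * int (n j))}"
proof -
  obtain h where "bij_betw h J {0..<card J}"
    using assms ex_bij_betw_finite_nat by blast
  then have inj: "inj_on h J" by (simp add: bij_betw_def)
  define g where "g = inv_into J h"
  have g: "g (h j) = j" if "j \<in> J" for j using inj that by (simp add: g_def)
  let ?X = "Inr ` h ` J :: ('d + nat) set"
  have inj': "inj_on (\<lambda>j. Inr (h j) :: 'd + nat) J" using inj by (auto simp: inj_on_def)
  have "\<exists>F. free_vars F \<subseteq> range Inl \<union> ?X \<and>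
      (\<forall>e. sat F e \<longleftrightarrow> (\<forall>i\<in>UNIV. int (e (Inl i)) = c $ i + (\<Sum>j\<in>J. b j $ i * int (e (Inr (h j))))))"
  proof (rule ex_conj_formula)
    fix i
    obtain t where t: "lin_vars t \<subseteq> ?X" "\<And>e. lin_val e t = c $ i +
        (\<Sum>v\<in>?X. case_sum (\<lambda>_. 0) (\<lambda>k. b (g k) $ i) v * int (e v))"
      using ex_lin_term[of ?X "c $ i" "case_sum (\<lambda>_. 0) (\<lambda>k. b (g k) $ i)"] assms by blast
    have "lin_val e t = c $ i + (\<Sum>j\<in>J. b j $ i * int (e (Inr (h j))))" for e
      unfolding t image_image by (subst sum.reindex[OF inj']) (simp add: g)
    then show "\<exists>F. free_vars F \<subseteq> range Inl \<union> ?X \<and>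
        (\<forall>e. sat F e \<longleftrightarrow> int (e (Inl i)) = c $ i + (\<Sum>j\<in>J. b j $ i * int (e (Inr (h j)))))"
      using t(1) by (intro exI[of _ "Eq (Var (Inl i)) t"]) auto
  qed simp
  then obtain F where F: "free_vars F \<subseteq> range Inl \<union> ?X"
    "\<And>e. sat F e \<longleftrightarrow> (\<forall>i. int (e (Inl i)) = c $ i + (\<Sum>j\<in>J. b j $ i * int (e (Inr (h j)))))"
    by auto
  obtain G where G: "free_vars G = free_vars F - ?X"
    "\<And>e. sat G e \<longleftrightarrow> (\<exists>n. sat F (\<lambda>v. if v \<in> ?X then n v else e v))"
    using ex_exists_formula[of ?X F] assms by blast
  have "sat G (coord_env u) \<longleftrightarrow>
      (\<exists>n. \<forall>i. int (u $ i) = c $ i + (\<Sum>j\<in>J. b j $ i * int (n j)))" for u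
  proof -
    have "(\<Sum>j\<in>J. b j $ i * int (if Inr (h j) \<in> ?X then n (Inr (h j)) else e (Inr (h j)))) =
        (\<Sum>j\<in>J. b j $ i * int (n (Inr (h j))))" for n e :: "'d + nat \<Rightarrow> nat" and i
      by (rule sum.cong) auto
    then have "sat G (coord_env u) \<longleftrightarrow>
      (\<exists>n. \<forall>i. int (u $ i) = c $ i + (\<Sum>j\<in>J. b j $ i * int (n (Inr (h j) :: 'd + nat))))"
      unfolding G F by (simp add: image_iff[of "Inl _"])
    also have "\<dots> \<longleftrightarrow> (\<exists>n. \<forall>i. int (u $ i) = c $ i + (\<Sum>j\<in>J. b j $ i * int (n j)))"
    proof
      assume "\<exists>n. \<forall>i. int (u $ i) = c $ i + (\<Sum>j\<in>J. b j $ i * int (n j))"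
      then obtain n where "\<forall>i. int (u $ i) = c $ i + (\<Sum>j\<in>J. b j $ i * int (n j))" by blast
      then show "\<exists>n. \<forall>i. int (u $ i) = c $ i + (\<Sum>j\<in>J. b j $ i * int (n (Inr (h j) :: 'd + nat)))"
        by (intro exI[of _ "case_sum (\<lambda>_. 0) (\<lambda>k. n (g k))"]) (simp add: g)
    next
      assume "\<exists>n. \<forall>i. int (u $ i) = c $ i + (\<Sum>j\<in>J. b j $ i * int (n (Inr (h j) :: 'd + nat)))"
      then obtain n where "\<forall>i. int (u $ i) = c $ i + (\<Sum>j\<in>J. b j $ i * int (n (Inr (h j) :: 'd + nat)))"
        by blast
      then show "\<exists>n. \<forall>i. int (u $ i) = c $ i + (\<Sum>j\<in>J. b j $ i * int (n j))"
        by (rule exI[of _ "\<lambda>j. n (Inr (h j))"])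
    qed
    finally show ?thesis .
  qed
  then show ?thesis
    unfolding presburger_set_def using F(1) G(1) by (intro exI[of _ G]) auto
qed

section \<open>Polyhedra and lattice cosets\<close>

definition int_vec :: "nat ^ 'd \<Rightarrow> int ^ 'd" where
  "int_vec u = (\<chi> i. int (u $ i))"

lemma real_vec_of_int_vec: "real_vec_of_int (int_vec u) = real_vec_of_nat u"
  by (simp add: real_vec_of_int_def real_vec_of_nat_def int_vec_def)

lemma inj_real_vec_of_int: "inj real_vec_of_int"
  by (auto simp: inj_def real_vec_of_int_def vec_eq_iff)

lemma inj_real_vec_of_nat: "inj real_vec_of_nat"
  by (auto simp: inj_def real_vec_of_nat_def vec_eq_iff)

lemma rational_polyhedron_Int:
  assumes "rational_polyhedron P" "rational_polyhedron Q" shows "rational_polyhedron (P \<inter> Q)"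
proof -
  obtain A B where "finite A" "P = {x. \<forall>(a, b)\<in>A. (\<Sum>i\<in>UNIV. of_rat (a $ i) * x $ i) \<le> of_rat b}"
    "finite B" "Q = {x. \<forall>(a, b)\<in>B. (\<Sum>i\<in>UNIV. of_rat (a $ i) * x $ i) \<le> of_rat b}"
    using assms unfolding rational_polyhedron_def by blast
  then show ?thesis unfolding rational_polyhedron_def by (intro exI[of _ "A \<union> B"]) auto
qed

lemma piece_empty: "polyhedral_lattice_piece {}"
proof -
  have "rational_polyhedron ({} :: (real ^ 'a) set)"
    unfolding rational_polyhedron_def by (intro exI[of _ "{(0, -1)}"]) auto
  moreover have "int_lattice ({0} :: (int ^ 'a) set)" by (simp add: int_lattice_def)
  ultimately show ?thesis unfolding polyhedral_lattice_piece_def by blast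
qed

lemma int_lattice_diff: "int_lattice L \<Longrightarrow> x \<in> L \<Longrightarrow> y \<in> L \<Longrightarrow> x - y \<in> L"
  unfolding int_lattice_def by (metis diff_conv_add_uminus)

text \<open>
  Any point of a coset may serve as its base point; hence two cosets with a common point \<open>w\<close>
  intersect in a coset based at \<open>w\<close>.
\<close>

lemma coset_eq:
  assumes "int_lattice L" "w \<in> (\<lambda>v. l + v) ` L"
  shows "(\<lambda>v. l + v) ` L = (\<lambda>v. w + v) ` L"
proof -
  obtain x where x: "x \<in> L" "w = l + x" using assms(2) by blast
  have "l + v \<in> (\<lambda>v. w + v) ` L" if "v \<in> L" for v
    using that x assms(1) by (intro image_eqI[of _ _ "v - x"]) (auto simp: int_lattice_diff)
  moreover have "w + v \<in> (\<lambda>v. l + v) ` L" if "v \<in> L" for v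
    using that x assms(1) by (intro image_eqI[of _ _ "x + v"]) (auto simp: int_lattice_def add.assoc)
  ultimately show ?thesis by blast
qed

lemma piece_Int:
  assumes "polyhedral_lattice_piece T" "polyhedral_lattice_piece T'"
  shows "polyhedral_lattice_piece (T \<inter> T')"
proof -
  obtain P l L P' l' L' where P: "rational_polyhedron P" "rational_polyhedron P'"
    and L: "int_lattice L" "int_lattice L'"
    and T: "T = P \<inter> real_vec_of_int ` ((\<lambda>v. l + v) ` L)" "T' = P' \<inter> real_vec_of_int ` ((\<lambda>v. l' + v) ` L')"
    using assms unfolding polyhedral_lattice_piece_def by blast
  have TT: "T \<inter> T' = (P \<inter> P') \<inter> real_vec_of_int ` ((\<lambda>v. l + v) ` L \<inter> (\<lambda>v. l' + v) ` L')"
    unfolding T image_Int[OF inj_real_vec_of_int] by blast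
  show ?thesis
  proof (cases "(\<lambda>v. l + v) ` L \<inter> (\<lambda>v. l' + v) ` L' = {}")
    case True
    then show ?thesis using TT piece_empty by simp
  next
    case False
    then obtain w where w: "w \<in> (\<lambda>v. l + v) ` L" "w \<in> (\<lambda>v. l' + v) ` L'" by blast
    have "(\<lambda>v. l + v) ` L \<inter> (\<lambda>v. l' + v) ` L' = (\<lambda>v. w + v) ` (L \<inter> L')"
      unfolding coset_eq[OF L(1) w(1)] coset_eq[OF L(2) w(2)] by auto
    moreover have "int_lattice (L \<inter> L')" using L by (simp add: int_lattice_def)
    ultimately show ?thesis using TT rational_polyhedron_Int[OF P]
      unfolding polyhedral_lattice_piece_def by metis
  qed
qed

lemma finite_union_of_pieces_empty: "finite_union_of_pieces {}"
  unfolding finite_union_of_pieces_def by (intro exI[of _ "{}"]) auto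

lemma finite_union_of_pieces_Un:
  assumes "finite_union_of_pieces S" "finite_union_of_pieces S'"
  shows "finite_union_of_pieces (S \<union> S')"
proof -
  obtain \<T> \<T>' where "finite \<T>" "\<forall>T\<in>\<T>. polyhedral_lattice_piece T" "real_vec_of_nat ` S = \<Union>\<T>"
    "finite \<T>'" "\<forall>T\<in>\<T>'. polyhedral_lattice_piece T" "real_vec_of_nat ` S' = \<Union>\<T>'"
    using assms unfolding finite_union_of_pieces_def by blast
  then show ?thesis unfolding finite_union_of_pieces_def
    by (intro exI[of _ "\<T> \<union> \<T>'"]) (auto simp: image_Un)
qed

lemma finite_union_of_pieces_Int:
  assumes "finite_union_of_pieces S" "finite_union_of_pieces S'"
  shows "finite_union_of_pieces (S \<inter> S')"
proof -
  obtain \<T> \<T>' where *: "finite \<T>" "\<forall>T\<in>\<T>. polyhedral_lattice_piece T" "real_vec_of_nat ` S = \<Union>\<T>"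
    "finite \<T>'" "\<forall>T\<in>\<T>'. polyhedral_lattice_piece T" "real_vec_of_nat ` S' = \<Union>\<T>'"
    using assms unfolding finite_union_of_pieces_def by blast
  have "real_vec_of_nat ` (S \<inter> S') = \<Union> ((\<lambda>(T, T'). T \<inter> T') ` (\<T> \<times> \<T>'))"
    unfolding image_Int[OF inj_real_vec_of_nat] * by blast
  then show ?thesis unfolding finite_union_of_pieces_def using *
    by (intro exI[of _ "(\<lambda>(T, T'). T \<inter> T') ` (\<T> \<times> \<T>')"]) (auto intro: piece_Int)
qed

lemma finite_union_of_pieces_UN:
  assumes "finite I" "\<And>i. i \<in> I \<Longrightarrow> finite_union_of_pieces (S i)"
  shows "finite_union_of_pieces (\<Union>i\<in>I. S i)"
  using assms by (induction I) (auto simp: finite_union_of_pieces_empty finite_union_of_pieces_Un)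

lemma finite_union_of_pieces_single:
  fixes A :: "((rat ^ 'd::finite) \<times> rat) set"
  assumes "finite A" "int_lattice L"
  shows "finite_union_of_pieces {u. (\<forall>(a, b)\<in>A. (\<Sum>i\<in>UNIV. of_rat (a $ i) * real (u $ i)) \<le> of_rat b) \<and>
    int_vec u \<in> (\<lambda>v. l + v) ` L}" (is "finite_union_of_pieces ?S")
proof -
  \<comment> \<open>The inequalities \<open>x\<^sub>i \<ge> 0\<close> keep the piece inside the image of \<open>\<nat>\<^sup>d\<close>.\<close>
  define B where "B = A \<union> range (\<lambda>i. (- axis i 1, 0))"
  define P :: "(real ^ 'd) set"
    where "P = {x. \<forall>(a, b)\<in>B. (\<Sum>i\<in>UNIV. of_rat (a $ i) * x $ i) \<le> of_rat b}"
  have nonneg: "(\<Sum>i\<in>UNIV. real_of_rat ((- axis j 1) $ i) * x $ i) = - (x $ j)" for x :: "real ^ 'd" and j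
  proof -
    have "(\<Sum>i\<in>UNIV. real_of_rat ((- axis j 1) $ i) * x $ i) = (\<Sum>i\<in>UNIV. if i = j then - (x $ i) else 0)"
      by (rule sum.cong) (auto simp: axis_def of_rat_minus)
    then show ?thesis by simp
  qed
  have P: "x \<in> P \<longleftrightarrow> (\<forall>(a, b)\<in>A. (\<Sum>i\<in>UNIV. of_rat (a $ i) * x $ i) \<le> of_rat b) \<and> (\<forall>i. x $ i \<ge> 0)" for x
    unfolding P_def B_def using nonneg[of _ x] by (auto simp: ball_Un)
  have "real_vec_of_nat ` ?S = P \<inter> real_vec_of_int ` ((\<lambda>v. l + v) ` L)"
  proof (intro equalityI subsetI)
    fix x assume "x \<in> real_vec_of_nat ` ?S"
    then obtain u where u: "x = real_vec_of_nat u" "u \<in> ?S" by blast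
    have "x = real_vec_of_int (int_vec u)" using u by (simp add: real_vec_of_int_vec)
    moreover have "x \<in> P" using u unfolding P by (auto simp: real_vec_of_nat_def)
    ultimately show "x \<in> P \<inter> real_vec_of_int ` ((\<lambda>v. l + v) ` L)" using u by blast
  next
    fix x assume "x \<in> P \<inter> real_vec_of_int ` ((\<lambda>v. l + v) ` L)"
    then obtain w where w: "x = real_vec_of_int w" "w \<in> (\<lambda>v. l + v) ` L" "x \<in> P" by blast
    define u where "u = (\<chi> i. nat (w $ i))"
    have "w $ i \<ge> 0" for i using w unfolding P by (auto simp: real_vec_of_int_def)
    then have "w = int_vec u" by (simp add: vec_eq_iff u_def int_vec_def)
    then have "x = real_vec_of_nat u" "int_vec u \<in> (\<lambda>v. l + v) ` L"
      using w by (simp_all add: real_vec_of_int_vec)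
    moreover have "u \<in> ?S" using \<open>x \<in> P\<close> calculation unfolding P by (auto simp: real_vec_of_nat_def)
    ultimately show "x \<in> real_vec_of_nat ` ?S" by blast
  qed
  moreover have "rational_polyhedron P"
    unfolding rational_polyhedron_def P_def using assms(1) by (intro exI[of _ B]) (auto simp: B_def)
  ultimately have "polyhedral_lattice_piece (real_vec_of_nat ` ?S)"
    unfolding polyhedral_lattice_piece_def using assms(2) by blast
  then show ?thesis unfolding finite_union_of_pieces_def
    by (intro exI[of _ "{real_vec_of_nat ` ?S}"]) auto
qed

lemma finite_union_of_pieces_halfspace:
  "finite_union_of_pieces ({u. 0 \<le> affine_form a c u} :: (nat ^ 'd::finite) set)"
proof -
  have L: "int_lattice (UNIV :: (int ^ 'd) set)" by (simp add: int_lattice_def)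
  let ?a = "(\<chi> i. - of_int (a $ i)) :: rat ^ 'd"
  have "(\<Sum>i\<in>UNIV. of_rat (?a $ i) * real (u $ i)) \<le> of_rat (of_int c) \<longleftrightarrow> 0 \<le> affine_form a c u"
    for u :: "nat ^ 'd"
  proof -
    have "0 \<le> affine_form a c u \<longleftrightarrow> 0 \<le> real_of_int (affine_form a c u)" by simp
    also have "real_of_int (affine_form a c u) = of_int c - (\<Sum>i\<in>UNIV. of_rat (?a $ i) * real (u $ i))"
      by (simp add: affine_form_def of_rat_minus sum_negf)
    finally show ?thesis by auto
  qed
  then show ?thesis
    using finite_union_of_pieces_single[of "{(?a, of_int c)}", OF _ L, of 0] by simp
qed

text \<open>
  The solutions of a congruence form a coset of the lattice of solutions of the homogeneous
  congruence, unless there is no solution at all.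
\<close>

lemma finite_union_of_pieces_congruence:
  "finite_union_of_pieces ({u. m dvd affine_form a c u} :: (nat ^ 'd::finite) set)"
proof (cases "\<exists>l. m dvd c + (\<Sum>i\<in>UNIV. a $ i * l $ i)")
  case True
  then obtain l where l: "m dvd c + (\<Sum>i\<in>UNIV. a $ i * l $ i)" by blast
  let ?L = "{v. m dvd (\<Sum>i\<in>UNIV. a $ i * v $ i)}"
  have L: "int_lattice ?L"
    by (auto simp: int_lattice_def algebra_simps sum.distrib sum_negf)
  have "m dvd affine_form a c u \<longleftrightarrow> int_vec u \<in> (\<lambda>v. l + v) ` ?L" for u
  proof -
    have "affine_form a c u = (c + (\<Sum>i\<in>UNIV. a $ i * l $ i)) + (\<Sum>i\<in>UNIV. a $ i * (int_vec u - l) $ i)"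
      by (simp add: affine_form_def int_vec_def algebra_simps sum_subtractf)
    then have "m dvd affine_form a c u \<longleftrightarrow> int_vec u - l \<in> ?L"
      using l by (simp add: dvd_add_right_iff)
    also have "\<dots> \<longleftrightarrow> int_vec u \<in> (\<lambda>v. l + v) ` ?L"
      by (metis (no_types, lifting) add_diff_cancel_left' diff_add_cancel add.commute imageE image_eqI)
    finally show ?thesis .
  qed
  then show ?thesis using finite_union_of_pieces_single[of "{}", OF _ L, of l] by simp
next
  case False
  have "\<not> m dvd affine_form a c u" for u
    using False by (metis (no_types, lifting) affine_form_def int_vec_def sum.cong vec_lambda_beta)
  then show ?thesis by (simp add: finite_union_of_pieces_empty)
qed

text \<open>Negations are pushed down to the atoms, which is why \<open>S\<close> and its complement are treated together.\<close>

lemma qf_set_imp_finite_union_of_pieces: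
  assumes "qf_set S"
  shows "finite_union_of_pieces S" "finite_union_of_pieces (- S)"
proof -
  have "finite_union_of_pieces S \<and> finite_union_of_pieces (- S)" using assms
  proof induction
    case (halfspace a c)
    have "affine_form (- a) (- 1 - c) u = - 1 - affine_form a c u" for u
      by (simp add: affine_form_def sum_negf)
    then have "- {u. 0 \<le> affine_form a c u} = {u. 0 \<le> affine_form (- a) (- 1 - c) u}" by auto
    then show ?case by (metis finite_union_of_pieces_halfspace)
  next
    case (congruence m a c)
    \<comment> \<open>A violated congruence is a disjunction of shifted congruences, again unions of cosets.\<close>
    have "\<not> m dvd x \<longleftrightarrow> (\<exists>r\<in>{1..<m}. m dvd r + x)" for x
    proof
      assume "\<not> m dvd x"
      then have "- x mod m \<noteq> 0" "0 \<le> - x mod m" "- x mod m < m" using congruence by (auto simp: mod_eq_0_iff_dvd)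
      moreover have "m dvd - x mod m + x" by (simp add: mod_eq_0_iff_dvd[symmetric] mod_simps)
      ultimately show "\<exists>r\<in>{1..<m}. m dvd r + x" by (intro bexI[of _ "- x mod m"]) auto
    next
      assume "\<exists>r\<in>{1..<m}. m dvd r + x"
      then show "\<not> m dvd x" using zdvd_not_zless by (auto simp: dvd_add_left_iff)
    qed
    then have "- {u. m dvd affine_form a c u} = (\<Union>r\<in>{1..<m}. {u. m dvd affine_form a (r + c) u})"
      by (auto simp: affine_form_add_const[symmetric])
    then show ?case
      using finite_union_of_pieces_UN[of "{1..<m}"] finite_union_of_pieces_congruence by (metis finite_atLeastLessThan_int)
  next
    case (compl S)
    then show ?case by simp
  next
    case (inter S T)
    then show ?case by (simp add: finite_union_of_pieces_Int finite_union_of_pieces_Un)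
  qed
  then show "finite_union_of_pieces S" "finite_union_of_pieces (- S)" by simp_all
qed

lemma int_lattice_scale:
  assumes "int_lattice L" "x \<in> L" shows "k *s x \<in> L"
proof -
  have nat: "int n *s x \<in> L" for n
    by (induction n) (use assms in \<open>auto simp: int_lattice_def vector_sadd_rdistrib\<close>)
  show ?thesis
  proof (cases "k \<ge> 0")
    case True
    then show ?thesis using nat[of "nat k"] by simp
  next
    case False
    then have "- (int (nat (- k)) *s x) \<in> L" using nat assms(1) unfolding int_lattice_def by blast
    moreover have "- (int (nat (- k)) *s x) = k *s x" using False by (simp add: vec_eq_iff)
    ultimately show ?thesis by metis
  qed
qed

text \<open>
  Induction on the set of coordinates that may be non-zero: a member of \<open>L\<close> whose coordinate \<open>i\<close>
  has the least positive absolute value generates \<open>L\<close> together with the sublattice on which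
  that coordinate vanishes, by division with remainder.
\<close>

lemma int_lattice_finitely_generated_aux:
  assumes "finite I" "int_lattice L" "\<And>x i. x \<in> L \<Longrightarrow> i \<notin> I \<Longrightarrow> x $ i = 0"
  shows "\<exists>G. finite G \<and> G \<subseteq> L \<and> (\<forall>x\<in>L. \<exists>k. x = (\<Sum>g\<in>G. k g *s g))"
  using assms
proof (induction I arbitrary: L)
  case empty
  then have "x = 0" if "x \<in> L" for x using that by (simp add: vec_eq_iff)
  then show ?case by (intro exI[of _ "{}"]) auto
next
  case (insert i I)
  let ?L = "{x \<in> L. x $ i = 0}"
  have "int_lattice ?L" using insert.prems(1) by (auto simp: int_lattice_def)
  then have "\<exists>G. finite G \<and> G \<subseteq> ?L \<and> (\<forall>x\<in>?L. \<exists>k. x = (\<Sum>g\<in>G. k g *s g))"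
    by (rule insert.IH) (use insert.prems(2) in \<open>metis (mono_tags, lifting) insertE mem_Collect_eq\<close>)
  then obtain G where G: "finite G" "G \<subseteq> ?L" "\<And>x. x \<in> ?L \<Longrightarrow> \<exists>k. x = (\<Sum>g\<in>G. k g *s g)"
    by blast
  show ?case
  proof (cases "L = ?L")
    case True
    then show ?thesis using G by (intro exI[of _ G]) auto
  next
    case False
    then obtain y where "y \<in> L \<and> y $ i \<noteq> 0" by blast
    from ex_has_least_nat[of "\<lambda>y. y \<in> L \<and> y $ i \<noteq> 0", OF this, of "\<lambda>y. nat \<bar>y $ i\<bar>"]
    obtain h where h: "h \<in> L" "h $ i \<noteq> 0" "\<And>y. y \<in> L \<Longrightarrow> y $ i \<noteq> 0 \<Longrightarrow> nat \<bar>h $ i\<bar> \<le> nat \<bar>y $ i\<bar>" by blast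
    have "\<exists>k. x = (\<Sum>g\<in>insert h G. k g *s g)" if x: "x \<in> L" for x
    proof -
      let ?q = "x $ i div h $ i"
      let ?y = "x + - (?q *s h)"
      have y: "?y \<in> L" using x insert.prems(1) int_lattice_scale[OF insert.prems(1) h(1)]
        by (metis int_lattice_def)
      have "?y $ i = x $ i mod h $ i" by (simp add: minus_mult_div_eq_mod[symmetric] mult.commute)
      moreover have "\<bar>x $ i mod h $ i\<bar> < \<bar>h $ i\<bar>" using h(2) by (rule abs_mod_less)
      ultimately have "?y $ i = 0" using h(3)[OF y] by force
      then obtain k where k: "?y = (\<Sum>g\<in>G. k g *s g)" using G(3)[of ?y] y by auto
      have "h \<notin> G" using G(2) h(2) by auto
      then have "(\<Sum>g\<in>insert h G. (k(h := ?q)) g *s g) = ?q *s h + (\<Sum>g\<in>G. (k(h := ?q)) g *s g)"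
        using G(1) by simp
      also have "(\<Sum>g\<in>G. (k(h := ?q)) g *s g) = (\<Sum>g\<in>G. k g *s g)"
        by (rule sum.cong) (use \<open>h \<notin> G\<close> in auto)
      also have "?q *s h + (\<Sum>g\<in>G. k g *s g) = x" unfolding k[symmetric] by simp
      finally show ?thesis by (intro exI[of _ "k(h := ?q)"]) (rule sym)
    qed
    then show ?thesis using G(1,2) h(1) by (intro exI[of _ "insert h G"]) auto
  qed
qed

lemma presburger_set_coset:
  fixes L :: "(int ^ 'd::finite) set"
  assumes "int_lattice L"
  shows "presburger_set {u. int_vec u \<in> (\<lambda>v. l + v) ` L}"
proof -
  obtain G where G: "finite G" "G \<subseteq> L" "\<And>x. x \<in> L \<Longrightarrow> \<exists>k. x = (\<Sum>g\<in>G. k g *s g)"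
    using int_lattice_finitely_generated_aux[of "UNIV :: 'd set", OF finite assms] by auto
  have sum_mem: "(\<Sum>g\<in>H. k g *s g) \<in> L" if "finite H" "H \<subseteq> L" for H k
    using that by (induction H) (use assms int_lattice_scale[OF assms] in \<open>auto simp: int_lattice_def\<close>)
  \<comment> \<open>Formulas quantify over \<open>\<nat>\<close> only, so every generator is used with both signs.\<close>
  define b where "b = (\<lambda>(g, s). if s then g else - g :: int ^ 'd)"
  have eq: "(\<Sum>j\<in>G \<times> UNIV. b j $ i * int (n j)) = (\<Sum>g\<in>G. (int (n (g, True)) - int (n (g, False))) * g $ i)"
    for n :: "(int ^ 'd) \<times> bool \<Rightarrow> nat" and i
  proof -
    have "(\<Sum>j\<in>G \<times> UNIV. b j $ i * int (n j)) = (\<Sum>g\<in>G. \<Sum>s\<in>UNIV. b (g, s) $ i * int (n (g, s)))"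
      by (simp add: sum.cartesian_product)
    then show ?thesis by (simp add: UNIV_bool b_def algebra_simps)
  qed
  have "int_vec u \<in> (\<lambda>v. l + v) ` L \<longleftrightarrow>
      (\<exists>n. \<forall>i. int (u $ i) = l $ i + (\<Sum>j\<in>G \<times> UNIV. b j $ i * int (n j)))" for u
  proof
    assume "int_vec u \<in> (\<lambda>v. l + v) ` L"
    then obtain k where k: "int_vec u = l + (\<Sum>g\<in>G. k g *s g)" using G(3) by force
    let ?n = "\<lambda>(g, s). if s then nat (k g) else nat (- k g)"
    have "int (u $ i) = l $ i + (\<Sum>j\<in>G \<times> UNIV. b j $ i * int (?n j))" for i
    proof -
      have "int (u $ i) = int_vec u $ i" by (simp add: int_vec_def)
      also have "\<dots> = l $ i + (\<Sum>g\<in>G. k g * g $ i)" unfolding k by simp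
      also have "(\<Sum>g\<in>G. k g * g $ i) = (\<Sum>j\<in>G \<times> UNIV. b j $ i * int (?n j))"
        unfolding eq by (rule sum.cong) auto
      finally show ?thesis .
    qed
    then show "\<exists>n. \<forall>i. int (u $ i) = l $ i + (\<Sum>j\<in>G \<times> UNIV. b j $ i * int (n j))" by blast
  next
    assume "\<exists>n. \<forall>i. int (u $ i) = l $ i + (\<Sum>j\<in>G \<times> UNIV. b j $ i * int (n j))"
    then obtain n where n: "\<And>i. int (u $ i) = l $ i + (\<Sum>j\<in>G \<times> UNIV. b j $ i * int (n j))" by blast
    have "int_vec u = l + (\<Sum>g\<in>G. (int (n (g, True)) - int (n (g, False))) *s g)"
      by (simp add: vec_eq_iff int_vec_def n eq left_diff_distrib)
    then show "int_vec u \<in> (\<lambda>v. l + v) ` L" by (rule image_eqI[OF _ sum_mem[OF G(1,2)]])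
  qed
  then show ?thesis using presburger_set_linear_image[of "G \<times> UNIV" l b] G(1) by simp
qed

lemma ex_common_denominator:
  assumes "finite Q" shows "\<exists>m > 0. \<forall>q\<in>Q. \<exists>k. of_int m * (q :: rat) = of_int k"
  using assms
proof (induction Q)
  case empty
  then show ?case by (intro exI[of _ 1]) auto
next
  case (insert x Q)
  then obtain m where m: "m > 0" "\<forall>q\<in>Q. \<exists>k. of_int m * q = of_int k" by blast
  obtain a b where "x = Fract a b" and b: "b > 0" by (cases x)
  then have x: "x = of_int a / of_int b" by (simp add: Fract_of_int_quotient)
  have "\<exists>k. of_int (b * m) * q = of_int k" if q: "q \<in> insert x Q" for q
  proof (cases "q = x")
    case True
    have "of_int (b * m) * q = of_int (m * a)" unfolding True using x b by simp
    then show ?thesis ..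
  next
    case False
    then obtain k where "of_int m * q = of_int k" using m(2) q by blast
    then have "of_int (b * m) * q = of_int (b * k)" by (simp add: mult.assoc)
    then show ?thesis ..
  qed
  then have "\<forall>q\<in>insert x Q. \<exists>k. of_int (b * m) * q = of_int k" ..
  moreover have "b * m > 0" using b m(1) by simp
  ultimately show ?case by (intro exI[of _ "b * m"] conjI)
qed

lemma presburger_set_rational_halfspace:
  "presburger_set ({u. (\<Sum>i\<in>UNIV. of_rat (a $ i) * real (u $ i)) \<le> of_rat b} :: (nat ^ 'd::finite) set)"
proof -
  obtain m where m: "m > 0" "\<And>q. q \<in> insert b (range (vec_nth a)) \<Longrightarrow> \<exists>k. of_int m * q = of_int k"
    using ex_common_denominator[of "insert b (range (vec_nth a))"] by auto
  obtain c where c: "of_int m * b = of_int c" using m(2) by blast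
  have "\<forall>i. \<exists>k. of_int m * a $ i = of_int k" using m(2) by blast
  then obtain k where k: "\<And>i. of_int m * a $ i = of_int (k i)" by (auto dest: choice)
  have "(\<Sum>i\<in>UNIV. of_rat (a $ i) * real (u $ i)) \<le> of_rat b \<longleftrightarrow> 0 \<le> affine_form (\<chi> i. - k i) c u"
    for u :: "nat ^ 'd"
  proof -
    have k': "of_int m * real_of_rat (a $ i) = of_int (k i)" for i
      using arg_cong[OF k, of real_of_rat i] by (simp add: of_rat_mult)
    have c': "of_int m * real_of_rat b = of_int c"
      using arg_cong[OF c, of real_of_rat] by (simp add: of_rat_mult)
    have "real_of_int (affine_form (\<chi> i. - k i) c u) =
        of_int m * (of_rat b - (\<Sum>i\<in>UNIV. of_rat (a $ i) * real (u $ i)))"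
      by (simp add: affine_form_def sum_negf algebra_simps sum_distrib_left c' flip: k')
    then have "0 \<le> real_of_int (affine_form (\<chi> i. - k i) c u) \<longleftrightarrow>
        (\<Sum>i\<in>UNIV. of_rat (a $ i) * real (u $ i)) \<le> of_rat b"
      using m(1) by (simp add: zero_le_mult_iff)
    then show ?thesis by simp
  qed
  then show ?thesis using presburger_set_halfspace by simp
qed

theorem finite_union_of_pieces_imp_presburger:
  fixes S :: "(nat ^ 'd::finite) set"
  assumes "finite_union_of_pieces S"
  shows "presburger_set S"
proof -
  obtain \<T> where \<T>: "finite \<T>" "\<And>T. T \<in> \<T> \<Longrightarrow> polyhedral_lattice_piece T" "real_vec_of_nat ` S = \<Union>\<T>"
    using assms unfolding finite_union_of_pieces_def by blast
  have S: "S = \<Union> ((\<lambda>T. real_vec_of_nat -` T) ` \<T>)"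
    using inj_vimage_image_eq[OF inj_real_vec_of_nat, of S] by (simp add: \<T>(3) vimage_Union)
  have "presburger_set (real_vec_of_nat -` T)" if T: "T \<in> \<T>" for T
  proof -
    obtain P l L where P: "rational_polyhedron P" "int_lattice L"
      "T = P \<inter> real_vec_of_int ` ((\<lambda>v. l + v) ` L)"
      using \<T>(2)[OF T] unfolding polyhedral_lattice_piece_def by blast
    obtain A where A: "finite A" "P = {x. \<forall>(a, b)\<in>A. (\<Sum>i\<in>UNIV. of_rat (a $ i) * x $ i) \<le> of_rat b}"
      using P(1) unfolding rational_polyhedron_def by blast
    have "real_vec_of_nat -` P =
        \<Inter> ((\<lambda>(a, b). {u. (\<Sum>i\<in>UNIV. of_rat (a $ i) * real (u $ i)) \<le> of_rat b}) ` A)"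
      unfolding A by (auto simp: real_vec_of_nat_def)
    moreover have "presburger_set X"
      if "X \<in> (\<lambda>(a, b). {u. (\<Sum>i\<in>UNIV. of_rat (a $ i) * real (u $ i)) \<le> of_rat b}) ` A" for X
      using that presburger_set_rational_halfspace by auto
    ultimately have 1: "presburger_set (real_vec_of_nat -` P)"
      by (simp only:) (rule presburger_set_Inter[OF finite_imageI[OF A(1)]])
    have "real_vec_of_nat u \<in> real_vec_of_int ` X \<longleftrightarrow> int_vec u \<in> X" for u :: "nat ^ 'd" and X
      unfolding real_vec_of_int_vec[symmetric] by (rule inj_image_mem_iff[OF inj_real_vec_of_int])
    then have "real_vec_of_nat -` T = real_vec_of_nat -` P \<inter> {u. int_vec u \<in> (\<lambda>v. l + v) ` L}"
      by (intro set_eqI) (simp only: P(3) vimage_eq Int_iff mem_Collect_eq)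
    then show ?thesis by (simp only: presburger_set_Int[OF 1 presburger_set_coset[OF P(2)]])
  qed
  then show ?thesis
    unfolding S by (intro presburger_set_Union finite_imageI \<T>(1)) (elim imageE, simp only:)
qed

section \<open>Cutting free linear sets\<close>

definition lin_comb :: "'i set \<Rightarrow> ('i \<Rightarrow> nat ^ 'd) \<Rightarrow> ('i \<Rightarrow> nat) \<Rightarrow> nat ^ 'd" where
  "lin_comb I b n = (\<Sum>i\<in>I. n i *s b i)"

text \<open>
  For finite \<open>I\<close> this is equivalent to linear independence over the rationals, since an integer
  relation can be written as an equation between two sums with natural coefficients. In this form
  it yields unique coordinates, and its failure yields such an equation, without linear algebra.
\<close>

definition nat_independent :: "'i set \<Rightarrow> ('i \<Rightarrow> nat ^ 'd) \<Rightarrow> bool" where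
  "nat_independent I b \<longleftrightarrow>
     (\<forall>n m. lin_comb I b n = lin_comb I b m \<longrightarrow> (\<forall>i\<in>I. n i = m i))"

definition lin_set :: "nat ^ 'd \<Rightarrow> 'i set \<Rightarrow> ('i \<Rightarrow> nat ^ 'd) \<Rightarrow> (nat ^ 'd) set" where
  "lin_set c I b = range (\<lambda>n. c + lin_comb I b n)"

lemma nat_independentD:
  "nat_independent I b \<Longrightarrow> lin_comb I b n = lin_comb I b m \<Longrightarrow> i \<in> I \<Longrightarrow> n i = m i"
  by (simp add: nat_independent_def)

lemma lin_comb_cong:
  "(\<And>i. i \<in> I \<Longrightarrow> n i = m i) \<Longrightarrow> (\<And>i. i \<in> I \<Longrightarrow> b i = b' i) \<Longrightarrow> lin_comb I b n = lin_comb I b' m"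
  by (simp add: lin_comb_def)

lemma lin_comb_remove:
  "finite I \<Longrightarrow> i \<in> I \<Longrightarrow> lin_comb I b n = n i *s b i + lin_comb (I - {i}) b n"
  by (simp add: lin_comb_def sum.remove)

lemma lin_comb_add: "lin_comb I b n + lin_comb I b m = lin_comb I b (\<lambda>i. n i + m i)"
  by (simp add: lin_comb_def sum.distrib vector_sadd_rdistrib)

lemma lin_comb_subset:
  assumes "finite I" "J \<subseteq> I"
  shows "lin_comb J b n = lin_comb I b (\<lambda>i. if i \<in> J then n i else 0)"
proof -
  have "lin_comb J b n = (\<Sum>i\<in>J. (if i \<in> J then n i else 0) *s b i)"
    unfolding lin_comb_def by (rule sum.cong) auto
  also have "\<dots> = lin_comb I b (\<lambda>i. if i \<in> J then n i else 0)"
    unfolding lin_comb_def by (rule sum.mono_neutral_left[OF assms]) simp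
  finally show ?thesis .
qed

lemma lin_comb_Suc:
  assumes "finite I" "i \<in> I"
  shows "b i + lin_comb I b n = lin_comb I b (n(i := Suc (n i)))"
proof -
  have "lin_comb (I - {i}) b (n(i := Suc (n i))) = lin_comb (I - {i}) b n" by (rule lin_comb_cong) auto
  moreover have "Suc (n i) *s b i = b i + n i *s b i" by (simp add: vec_eq_iff)
  ultimately show ?thesis
    using lin_comb_remove[OF assms, of b n] lin_comb_remove[OF assms, of b "n(i := Suc (n i))"]
    by (simp add: add.assoc)
qed

lemma lin_comb_scale: "lin_comb I (\<lambda>i. m i *s b i) n = lin_comb I b (\<lambda>i. m i * n i)"
  by (simp add: lin_comb_def mult.commute)

lemma nat_independent_subset:
  assumes "nat_independent I b" "finite I" "J \<subseteq> I"
  shows "nat_independent J b"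
  unfolding nat_independent_def lin_comb_subset[OF assms(2,3)]
proof (intro allI impI ballI)
  fix n m i assume "lin_comb I b (\<lambda>i. if i \<in> J then n i else 0) = lin_comb I b (\<lambda>i. if i \<in> J then m i else 0)"
    and i: "i \<in> J"
  from nat_independentD[OF assms(1) this(1), of i] show "n i = m i" using i assms(3) by auto
qed

lemma nat_independent_scale:
  assumes "nat_independent I b" "\<And>i. i \<in> I \<Longrightarrow> m i > 0"
  shows "nat_independent I (\<lambda>i. m i *s b i)"
  unfolding nat_independent_def lin_comb_scale
proof (intro allI impI ballI)
  fix n n' i assume "lin_comb I b (\<lambda>i. m i * n i) = lin_comb I b (\<lambda>i. m i * n' i)" and i: "i \<in> I"
  from nat_independentD[OF assms(1) this] show "n i = n' i" using assms(2)[OF i] by simp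
qed

lemma lin_set_memI: "c + lin_comb I b n \<in> lin_set c I b"
  by (simp add: lin_set_def)

text \<open>
  The points are sorted according to whether the coefficient of \<open>b i\<close> is zero or positive.
\<close>

lemma lin_set_remove:
  assumes I: "finite I" "i \<in> I" and ind: "nat_independent I b"
  shows "lin_set c I b = lin_set c (I - {i}) b \<union> lin_set (c + b i) I b"
    and "lin_set c (I - {i}) b \<inter> lin_set (c + b i) I b = {}"
proof -
  let ?z = "\<lambda>n j. if j \<in> I - {i} then n j else (0 :: nat)"
  have z: "lin_comb (I - {i}) b n = lin_comb I b (?z n)" for n
    by (rule lin_comb_subset) (use I in auto)
  have s: "c + b i + lin_comb I b n = c + lin_comb I b (n(i := Suc (n i)))" for n
    by (simp add: add.assoc lin_comb_Suc[OF I])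
  have "c + lin_comb I b n \<in> lin_set c (I - {i}) b \<union> lin_set (c + b i) I b" for n
  proof (cases "n i")
    case 0
    then have "lin_comb I b n = lin_comb (I - {i}) b n" using lin_comb_remove[OF I, of b n] by simp
    then show ?thesis using lin_set_memI[of c "I - {i}" b n] by simp
  next
    case (Suc k)
    then have "n = (n(i := k))(i := Suc ((n(i := k)) i))" by auto
    then have "c + lin_comb I b n = c + b i + lin_comb I b (n(i := k))" by (simp only: s)
    then show ?thesis using lin_set_memI[of "c + b i" I b "n(i := k)"] by simp
  qed
  moreover have "c + lin_comb (I - {i}) b n \<in> lin_set c I b" for n
    unfolding z by (rule lin_set_memI)
  moreover have "c + b i + lin_comb I b n \<in> lin_set c I b" for n
    unfolding s by (rule lin_set_memI)
  ultimately show "lin_set c I b = lin_set c (I - {i}) b \<union> lin_set (c + b i) I b"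
    unfolding lin_set_def by blast
  have "c + lin_comb (I - {i}) b n \<noteq> c + b i + lin_comb I b m" for n m
  proof
    assume "c + lin_comb (I - {i}) b n = c + b i + lin_comb I b m"
    then have "lin_comb I b (?z n) = lin_comb I b (m(i := Suc (m i)))" unfolding s z by simp
    from nat_independentD[OF ind this I(2)] show False by simp
  qed
  then show "lin_set c (I - {i}) b \<inter> lin_set (c + b i) I b = {}"
    unfolding lin_set_def by blast
qed

text \<open>
  Replacing the generator \<open>b j\<close> by \<open>b i + b j\<close> amounts to adding the coefficient \<open>n j\<close> to \<open>n i\<close>. So the
  new generators reach exactly the points whose coefficient at \<open>i\<close> is at least the one at \<open>j\<close>.
\<close>

lemma lin_comb_add_generator:
  assumes I: "finite I" "i \<in> I" "j \<in> I" "i \<noteq> j"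
  shows "lin_comb I (b(j := b i + b j)) n = lin_comb I b (n(i := n i + n j))"
proof -
  have split: "lin_comb I d m = m i *s d i + (m j *s d j + lin_comb (I - {i} - {j}) d m)" for d m
    using lin_comb_remove[of I i d m] lin_comb_remove[of "I - {i}" j d m] I by simp
  have "lin_comb (I - {i} - {j}) (b(j := b i + b j)) n = lin_comb (I - {i} - {j}) b (n(i := n i + n j))"
    by (rule lin_comb_cong) auto
  moreover have "n i *s b i + n j *s (b i + b j) = (n i + n j) *s b i + n j *s b j"
    by (simp add: vec_eq_iff algebra_simps)
  ultimately show ?thesis
    using I(4) split[of "b(j := b i + b j)" n] split[of b "n(i := n i + n j)"] by (simp add: add.assoc[symmetric])
qed

lemma nat_independent_add_generator:
  assumes I: "finite I" "i \<in> I" "j \<in> I" "i \<noteq> j" and ind: "nat_independent I b"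
  shows "nat_independent I (b(j := b i + b j))"
  unfolding nat_independent_def lin_comb_add_generator[OF I]
proof (intro allI impI ballI)
  fix n m k assume *: "lin_comb I b (n(i := n i + n j)) = lin_comb I b (m(i := m i + m j))" and k: "k \<in> I"
  show "n k = m k"
    using nat_independentD[OF ind * I(2)] nat_independentD[OF ind * I(3)] nat_independentD[OF ind * k] I(4)
    by (cases "k = i") auto
qed

text \<open>
  Elliott's step. The first part contains the points with \<open>n i \<ge> n j\<close>, the second part those with
  \<open>n i < n j\<close>; the shift by \<open>b j\<close> accounts for the strict inequality.
\<close>

lemma lin_set_elliott:
  assumes I: "finite I" "i \<in> I" "j \<in> I" "i \<noteq> j" and ind: "nat_independent I b"
  shows "lin_set c I b = lin_set c I (b(j := b i + b j)) \<union> lin_set (c + b j) I (b(i := b j + b i))"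
    and "lin_set c I (b(j := b i + b j)) \<inter> lin_set (c + b j) I (b(i := b j + b i)) = {}"
proof -
  note left = lin_comb_add_generator[OF I, of b]
  have right: "c + b j + lin_comb I (b(i := b j + b i)) n = c + lin_comb I b (n(j := Suc (n j + n i)))" for n
    using lin_comb_add_generator[OF I(1) I(3) I(2) I(4)[symmetric], of b n] lin_comb_Suc[OF I(1,3), of b "n(j := n j + n i)"]
    by (simp add: add.assoc)
  have "c + lin_comb I b n \<in> lin_set c I (b(j := b i + b j)) \<union> lin_set (c + b j) I (b(i := b j + b i))" for n
  proof (cases "n i \<ge> n j")
    case True
    then have "n = (n(i := n i - n j))(i := (n(i := n i - n j)) i + (n(i := n i - n j)) j)" using I(4) by auto
    then have "c + lin_comb I b n = c + lin_comb I (b(j := b i + b j)) (n(i := n i - n j))" by (simp only: left)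
    then show ?thesis using lin_set_memI[of c I "b(j := b i + b j)" "n(i := n i - n j)"] by simp
  next
    case False
    let ?n = "n(j := n j - Suc (n i))"
    have "n = ?n(j := Suc (?n j + ?n i))" using I(4) False by auto
    then have "c + lin_comb I b n = c + b j + lin_comb I (b(i := b j + b i)) ?n" by (simp only: right)
    then show ?thesis using lin_set_memI[of "c + b j" I "b(i := b j + b i)" ?n] by simp
  qed
  moreover have "c + lin_comb I (b(j := b i + b j)) n \<in> lin_set c I b" for n
    unfolding left by (rule lin_set_memI)
  moreover have "c + b j + lin_comb I (b(i := b j + b i)) n \<in> lin_set c I b" for n
    unfolding right by (rule lin_set_memI)
  ultimately show "lin_set c I b = lin_set c I (b(j := b i + b j)) \<union> lin_set (c + b j) I (b(i := b j + b i))"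
    unfolding lin_set_def by blast
  have "c + lin_comb I (b(j := b i + b j)) n \<noteq> c + b j + lin_comb I (b(i := b j + b i)) m" for n m
  proof
    assume "c + lin_comb I (b(j := b i + b j)) n = c + b j + lin_comb I (b(i := b j + b i)) m"
    then have *: "lin_comb I b (n(i := n i + n j)) = lin_comb I b (m(j := Suc (m j + m i)))"
      unfolding left right by simp
    from nat_independentD[OF ind * I(2)] nat_independentD[OF ind * I(3)] show False using I(4) by simp
  qed
  then show "lin_set c I (b(j := b i + b j)) \<inter> lin_set (c + b j) I (b(i := b j + b i)) = {}"
    unfolding lin_set_def by blast
qed

text \<open>
  Division with remainder by \<open>m i\<close> in every coefficient: the remainders \<open>r\<close> select the part, the
  quotients are the new coefficients.
\<close>

lemma lin_set_scale:
  fixes c :: "nat ^ 'd"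
  assumes ind: "nat_independent I b" and m: "\<And>i. i \<in> I \<Longrightarrow> m i > 0"
  defines "S \<equiv> \<lambda>r. lin_set (c + lin_comb I b r) I (\<lambda>i. m i *s b i)"
  shows "lin_set c I b = \<Union> (S ` (\<Pi>\<^sub>E i\<in>I. {..<m i}))"
    and "disjoint (S ` (\<Pi>\<^sub>E i\<in>I. {..<m i}))"
proof -
  have S: "S r = range (\<lambda>q. c + lin_comb I b (\<lambda>i. r i + m i * q i))" for r
    by (simp add: S_def lin_set_def lin_comb_scale add.assoc lin_comb_add)
  have "c + lin_comb I b n \<in> \<Union> (S ` (\<Pi>\<^sub>E i\<in>I. {..<m i}))" for n
  proof -
    define r where "r = restrict (\<lambda>i. n i mod m i) I"
    have "r \<in> (\<Pi>\<^sub>E i\<in>I. {..<m i})" using m by (auto simp: r_def)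
    moreover have "lin_comb I b n = lin_comb I b (\<lambda>i. r i + m i * (n i div m i))"
      by (rule lin_comb_cong) (auto simp: r_def)
    then have "c + lin_comb I b n \<in> S r" unfolding S by simp
    ultimately show ?thesis by blast
  qed
  then show "lin_set c I b = \<Union> (S ` (\<Pi>\<^sub>E i\<in>I. {..<m i}))"
    unfolding lin_set_def S by blast
  show "disjoint (S ` (\<Pi>\<^sub>E i\<in>I. {..<m i}))"
  proof (rule disjointI)
    fix X Y assume XY: "X \<in> S ` (\<Pi>\<^sub>E i\<in>I. {..<m i})" "Y \<in> S ` (\<Pi>\<^sub>E i\<in>I. {..<m i})" "X \<noteq> Y"
    then obtain r r' where r: "r \<in> (\<Pi>\<^sub>E i\<in>I. {..<m i})" "r' \<in> (\<Pi>\<^sub>E i\<in>I. {..<m i})" "X = S r" "Y = S r'"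
      by blast
    have "c + lin_comb I b (\<lambda>i. r i + m i * q i) \<noteq> c + lin_comb I b (\<lambda>i. r' i + m i * q' i)" for q q'
    proof
      assume "c + lin_comb I b (\<lambda>i. r i + m i * q i) = c + lin_comb I b (\<lambda>i. r' i + m i * q' i)"
      then have "lin_comb I b (\<lambda>i. r i + m i * q i) = lin_comb I b (\<lambda>i. r' i + m i * q' i)" by simp
      note eq = nat_independentD[OF ind this]
      have "r i = r' i" if i: "i \<in> I" for i
      proof -
        have "r i < m i" "r' i < m i" using r(1,2) i by auto
        then show ?thesis using arg_cong[OF eq[OF i], of "\<lambda>x. x mod m i"] by simp
      qed
      then have "r = r'" using r(1,2) by (rule PiE_ext[rotated 2])
      then show False using XY(3) r(3,4) by simp
    qed
    then show "X \<inter> Y = {}" unfolding r(3,4) S by blast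
  qed
qed

text \<open>
  Only index sets within \<open>'d\<close> are admitted. No operation below enlarges the index set, and
  \<open>\<nat>\<^sup>d\<close> itself is generated by the family of unit vectors.
\<close>

definition free_linear :: "(nat ^ 'd) set \<Rightarrow> bool" where
  "free_linear F \<longleftrightarrow> (\<exists>c (I :: 'd set) b. nat_independent I b \<and> F = lin_set c I b)"

definition partition_into_free :: "(nat ^ 'd) set set \<Rightarrow> (nat ^ 'd) set \<Rightarrow> bool" where
  "partition_into_free \<F> F \<longleftrightarrow> finite \<F> \<and> (\<forall>G\<in>\<F>. free_linear G) \<and> disjoint \<F> \<and> \<Union>\<F> = F"

text \<open>
  Treating \<open>Q\<close> and its complement alike makes sets that can be cut by \<open>Q\<close> closed under Boolean
  operations on \<open>Q\<close>.
\<close>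

definition homogeneous :: "'a set \<Rightarrow> 'a set \<Rightarrow> bool" where
  "homogeneous Q G \<longleftrightarrow> G \<subseteq> Q \<or> G \<inter> Q = {}"

definition splits :: "(nat ^ 'd) set set \<Rightarrow> (nat ^ 'd) set \<Rightarrow> bool" where
  "splits \<Q> F \<longleftrightarrow>
     (\<exists>\<F>. partition_into_free \<F> F \<and> (\<forall>G\<in>\<F>. \<forall>Q\<in>\<Q>. homogeneous Q G))"

lemma homogeneous_partition_Union:
  assumes "partition_into_free \<F> UNIV" "\<And>G. G \<in> \<F> \<Longrightarrow> homogeneous S G"
  shows "S = \<Union> {G \<in> \<F>. G \<subseteq> S}"
proof (intro equalityI subsetI)
  fix u assume u: "u \<in> S"
  have "u \<in> \<Union>\<F>" using assms(1) by (simp add: partition_into_free_def)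
  then obtain G where G: "G \<in> \<F>" "u \<in> G" by blast
  then have "G \<subseteq> S" using assms(2)[OF G(1)] u by (auto simp: homogeneous_def)
  then show "u \<in> \<Union> {G \<in> \<F>. G \<subseteq> S}" using G by blast
qed blast

lemma splits_const:
  assumes "free_linear F" "\<And>Q. Q \<in> \<Q> \<Longrightarrow> homogeneous Q F" shows "splits \<Q> F"
  unfolding splits_def partition_into_free_def using assms
  by (intro exI[of _ "{F}"]) (simp add: disjoint_def)

lemma splits_Union:
  assumes "finite \<F>" "disjoint \<F>" "\<And>G. G \<in> \<F> \<Longrightarrow> splits \<Q> G" shows "splits \<Q> (\<Union>\<F>)"
proof -
  have "\<forall>G\<in>\<F>. \<exists>\<H>. partition_into_free \<H> G \<and> (\<forall>H\<in>\<H>. \<forall>Q\<in>\<Q>. homogeneous Q H)"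
    using assms(3) unfolding splits_def by blast
  from bchoice[OF this] obtain h where h: "\<forall>G\<in>\<F>. partition_into_free (h G) G \<and>
      (\<forall>H\<in>h G. \<forall>Q\<in>\<Q>. homogeneous Q H)" ..
  have part: "partition_into_free (h G) G" if "G \<in> \<F>" for G using h that by simp
  have const: "\<forall>Q\<in>\<Q>. homogeneous Q H" if "G \<in> \<F>" "H \<in> h G" for G H using h that by simp
  have un: "\<Union> (h G) = G" if "G \<in> \<F>" for G using part[OF that] by (simp add: partition_into_free_def)
  have "disjoint (\<Union>G\<in>\<F>. h G)"
  proof (rule disjointI)
    fix X Y assume "X \<in> (\<Union>G\<in>\<F>. h G)" "Y \<in> (\<Union>G\<in>\<F>. h G)" and XY: "X \<noteq> Y"
    then obtain G G' where G: "G \<in> \<F>" "X \<in> h G" "G' \<in> \<F>" "Y \<in> h G'" by blast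
    show "X \<inter> Y = {}"
    proof (cases "G = G'")
      case True
      then show ?thesis using part[OF G(1)] G XY unfolding partition_into_free_def disjoint_def by simp
    next
      case False
      then have "G \<inter> G' = {}" using G assms(2) by (simp add: disjoint_def)
      moreover have "X \<subseteq> G" "Y \<subseteq> G'"
        using un[OF G(1)] un[OF G(3)] G(2,4) by blast+
      ultimately show ?thesis by blast
    qed
  qed
  moreover have "\<Union> (\<Union>G\<in>\<F>. h G) = \<Union>\<F>"
  proof -
    have "\<Union> (\<Union>G\<in>\<F>. h G) = (\<Union>G\<in>\<F>. \<Union> (h G))" by blast
    then show ?thesis by (simp add: un)
  qed
  moreover have "finite (\<Union>G\<in>\<F>. h G)"
    using part assms(1) by (simp add: partition_into_free_def)
  moreover have "free_linear H" if "H \<in> (\<Union>G\<in>\<F>. h G)" for H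
    using that part by (auto simp: partition_into_free_def)
  ultimately have "partition_into_free (\<Union>G\<in>\<F>. h G) (\<Union>\<F>)"
    by (simp add: partition_into_free_def)
  moreover have "\<forall>H\<in>(\<Union>G\<in>\<F>. h G). \<forall>Q\<in>\<Q>. homogeneous Q H"
    using const by (intro ballI) (elim UN_E, blast)
  ultimately show ?thesis unfolding splits_def by (intro exI[of _ "\<Union>G\<in>\<F>. h G"] conjI)
qed

lemma splits_Un:
  assumes "splits \<Q> F" "splits \<Q> G" "F \<inter> G = {}" shows "splits \<Q> (F \<union> G)"
proof -
  have "splits \<Q> (\<Union> {F, G})"
    by (rule splits_Union) (use assms in \<open>auto simp: disjoint_def\<close>)
  then show ?thesis by simp
qed

lemma splits_insert:
  assumes "splits \<Q> F" "\<And>G. free_linear G \<Longrightarrow> splits {Q} G"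
  shows "splits (insert Q \<Q>) F"
proof -
  obtain \<F> where F: "partition_into_free \<F> F" "\<And>G P. G \<in> \<F> \<Longrightarrow> P \<in> \<Q> \<Longrightarrow> homogeneous P G"
    using assms(1) unfolding splits_def by blast
  have "splits (insert Q \<Q>) G" if G: "G \<in> \<F>" for G
  proof -
    have "free_linear G" using F(1) G by (simp add: partition_into_free_def)
    from assms(2)[OF this] obtain \<H> where H: "partition_into_free \<H> G"
      "\<And>H. H \<in> \<H> \<Longrightarrow> homogeneous Q H"
      by (auto simp: splits_def)
    have "homogeneous P H" if "H \<in> \<H>" "P \<in> insert Q \<Q>" for H P
    proof -
      have "H \<subseteq> G" using H(1) that(1) unfolding partition_into_free_def by blast
      then show ?thesis
        using F(2)[OF G, of P] H(2)[OF that(1)] that(2) unfolding homogeneous_def by blast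
    qed
    then have "\<forall>H\<in>\<H>. \<forall>P\<in>insert Q \<Q>. homogeneous P H" by (intro ballI)
    with H(1) show ?thesis unfolding splits_def by (intro exI[of _ \<H>] conjI)
  qed
  then have "splits (insert Q \<Q>) (\<Union>\<F>)"
    by (intro splits_Union) (use F(1) in \<open>auto simp: partition_into_free_def\<close>)
  then show ?thesis using F(1) by (simp add: partition_into_free_def)
qed

lemma splits_finite:
  assumes "finite \<Q>" "\<And>Q G. Q \<in> \<Q> \<Longrightarrow> free_linear G \<Longrightarrow> splits {Q} G" "free_linear F"
  shows "splits \<Q> F"
  using assms(1,2)
proof (induction \<Q>)
  case empty
  show ?case using assms(3) by (rule splits_const) simp
next
  case (insert Q \<Q>)
  show ?case
    by (rule splits_insert) (use insert in auto)
qed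

lemma splits_Compl: "splits {Q} F \<Longrightarrow> splits {- Q} F"
  unfolding splits_def homogeneous_def by (elim exE conjE, intro exI conjI, assumption) blast

lemma affine_form_plus: "affine_form a c (u + v) = affine_form a c u + affine_form a 0 v"
  by (simp add: affine_form_def algebra_simps sum.distrib)

lemma affine_form_lin_comb:
  "affine_form a 0 (lin_comb I b n) = (\<Sum>i\<in>I. int (n i) * affine_form a 0 (b i))"
proof -
  have "affine_form a 0 (lin_comb I b n) = (\<Sum>k\<in>UNIV. \<Sum>i\<in>I. int (n i) * (a $ k * int (b i $ k)))"
    by (simp add: affine_form_def lin_comb_def sum_distrib_left mult_ac)
  also have "\<dots> = (\<Sum>i\<in>I. \<Sum>k\<in>UNIV. int (n i) * (a $ k * int (b i $ k)))" by (rule sum.swap)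
  finally show ?thesis by (simp add: affine_form_def sum_distrib_left)
qed

lemma free_linear_lin_set: "nat_independent (I :: 'd set) b \<Longrightarrow> free_linear (lin_set c I (b :: 'd \<Rightarrow> nat ^ 'd))"
  unfolding free_linear_def by blast

text \<open>
  If the base point violates the inequality, a generator of positive value is split off. In one
  part this generator is gone, in the other one the base point is closer to the half-space.
\<close>

lemma splits_halfspace_nonneg:
  fixes b :: "'d::finite \<Rightarrow> nat ^ 'd"
  assumes "nat_independent I b" "\<And>i. i \<in> I \<Longrightarrow> affine_form a 0 (b i) \<ge> 0"
  shows "splits {{u. 0 \<le> affine_form a k u}} (lin_set c I b)"
  using assms
proof (induction "card {i \<in> I. affine_form a 0 (b i) > 0} + nat (- affine_form a k c)"
    arbitrary: c I rule: less_induct)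
  case less
  have free: "free_linear (lin_set c I b)" using less.prems(1) by (rule free_linear_lin_set)
  have val: "affine_form a k (c + lin_comb I b n) =
      affine_form a k c + (\<Sum>i\<in>I. int (n i) * affine_form a 0 (b i))" for n
    by (simp add: affine_form_plus affine_form_lin_comb)
  show ?case
  proof (cases "affine_form a k c \<ge> 0")
    case True
    have "0 \<le> affine_form a k (c + lin_comb I b n)" for n
      unfolding val using True less.prems(2) by (simp add: sum_nonneg)
    then show ?thesis by (intro splits_const[OF free]) (auto simp: homogeneous_def lin_set_def)
  next
    case neg: False
    show ?thesis
    proof (cases "\<exists>i\<in>I. affine_form a 0 (b i) > 0")
      case False
      then have "\<And>i. i \<in> I \<Longrightarrow> affine_form a 0 (b i) = 0" using less.prems(2) by force
      then have "\<not> 0 \<le> affine_form a k (c + lin_comb I b n)" for n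
        unfolding val using neg by simp
      then show ?thesis by (intro splits_const[OF free]) (auto simp: homogeneous_def lin_set_def)
    next
      case True
      then obtain i where i: "i \<in> I" "affine_form a 0 (b i) > 0" by blast
      have "{j \<in> I - {i}. affine_form a 0 (b j) > 0} \<subset> {j \<in> I. affine_form a 0 (b j) > 0}"
        using i by auto
      then have "card {j \<in> I - {i}. affine_form a 0 (b j) > 0} < card {j \<in> I. affine_form a 0 (b j) > 0}"
        by (intro psubset_card_mono) auto
      then have 1: "splits {{u. 0 \<le> affine_form a k u}} (lin_set c (I - {i}) b)"
        using less.prems by (intro less.hyps nat_independent_subset[OF less.prems(1)]) auto
      have "nat (- affine_form a k (c + b i)) < nat (- affine_form a k c)"
        using neg i(2) by (simp add: affine_form_plus)
      then have 2: "splits {{u. 0 \<le> affine_form a k u}} (lin_set (c + b i) I b)"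
        using less.prems by (intro less.hyps) auto
      show ?thesis
        using splits_Un[OF 1 2 lin_set_remove(2)[OF finite i(1) less.prems(1)]]
        by (simp only: lin_set_remove(1)[OF finite i(1) less.prems(1), symmetric])
    qed
  qed
qed

lemma splits_halfspace_nonpos:
  fixes b :: "'d::finite \<Rightarrow> nat ^ 'd"
  assumes "nat_independent I b" "\<And>i. i \<in> I \<Longrightarrow> affine_form a 0 (b i) \<le> 0"
  shows "splits {{u. 0 \<le> affine_form a k u}} (lin_set c I b)"
proof -
  have neg: "affine_form (- a) (x - k) u = x - affine_form a k u" for x k u
    by (simp add: affine_form_def sum_negf)
  \<comment> \<open>Over the integers the complement of a half-space is a half-space for the negated form.\<close>
  have "splits {{u. 0 \<le> affine_form (- a) (- 1 - k) u}} (lin_set c I b)"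
    by (rule splits_halfspace_nonneg[OF assms(1)]) (use assms(2) neg[of 0 0] in simp)
  moreover have "- {u. 0 \<le> affine_form (- a) (- 1 - k) u} = {u. 0 \<le> affine_form a k u}"
    unfolding neg by auto
  ultimately show ?thesis using splits_Compl by metis
qed

text \<open>
  Combining a generator of value \<open>D\<close> with one of value \<open>-D\<close> gives one of value \<open>0\<close>, so in both
  parts fewer generators have a non-zero value. Once the values all have the same sign, the
  two preceding lemmas apply.
\<close>

lemma splits_halfspace_unit:
  fixes b :: "'d::finite \<Rightarrow> nat ^ 'd"
  assumes "nat_independent I b" "\<And>i. i \<in> I \<Longrightarrow> affine_form a 0 (b i) \<in> {- D, 0, D}" "D > 0"
  shows "splits {{u. 0 \<le> affine_form a k u}} (lin_set c I b)"
  using assms(1,2)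
proof (induction "card {i \<in> I. affine_form a 0 (b i) \<noteq> 0}" arbitrary: c b rule: less_induct)
  case less
  note ind = less.prems(1)
  show ?case
  proof (cases "\<exists>i\<in>I. \<exists>j\<in>I. affine_form a 0 (b i) = D \<and> affine_form a 0 (b j) = - D")
    case True
    then obtain i j where ij: "i \<in> I" "j \<in> I" "affine_form a 0 (b i) = D" "affine_form a 0 (b j) = - D"
      by blast
    then have ne: "i \<noteq> j" using assms(3) by auto
    have sum0: "affine_form a 0 (b i + b j) = 0" "affine_form a 0 (b j + b i) = 0"
      using ij by (simp_all add: affine_form_plus)
    have dec: "splits {{u. 0 \<le> affine_form a k u}} (lin_set c' I (b(j' := v)))"
      if j': "j' \<in> I" "affine_form a 0 (b j') \<noteq> 0" and v: "affine_form a 0 v = 0"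
        "nat_independent I (b(j' := v))" for j' v c'
    proof (rule less.hyps[OF _ v(2)])
      have "{i \<in> I. affine_form a 0 ((b(j' := v)) i) \<noteq> 0} \<subset> {i \<in> I. affine_form a 0 (b i) \<noteq> 0}"
        using j' v(1) by auto
      then show "card {i \<in> I. affine_form a 0 ((b(j' := v)) i) \<noteq> 0} < card {i \<in> I. affine_form a 0 (b i) \<noteq> 0}"
        by (intro psubset_card_mono) auto
    qed (use less.prems(2) v(1) in auto)
    have 1: "splits {{u. 0 \<le> affine_form a k u}} (lin_set c I (b(j := b i + b j)))"
      using ij assms(3) ne sum0 by (intro dec nat_independent_add_generator[OF _ _ _ _ ind]) auto
    have 2: "splits {{u. 0 \<le> affine_form a k u}} (lin_set (c + b j) I (b(i := b j + b i)))"
      using ij assms(3) ne sum0 by (intro dec nat_independent_add_generator[OF _ _ _ _ ind]) auto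
    show ?thesis
      using splits_Un[OF 1 2 lin_set_elliott(2)[OF finite ij(1,2) ne ind]]
      by (simp only: lin_set_elliott(1)[OF finite ij(1,2) ne ind, symmetric])
  next
    case False
    then have "(\<forall>i\<in>I. affine_form a 0 (b i) \<ge> 0) \<or> (\<forall>i\<in>I. affine_form a 0 (b i) \<le> 0)"
      using less.prems(2) assms(3) by fastforce
    then show ?thesis using splits_halfspace_nonneg[OF ind] splits_halfspace_nonpos[OF ind] by blast
  qed
qed

lemma splits_scale:
  fixes b :: "'d::finite \<Rightarrow> nat ^ 'd"
  assumes ind: "nat_independent I b" and m: "\<And>i. i \<in> I \<Longrightarrow> m i > 0"
    and "\<And>c. splits \<Q> (lin_set c I (\<lambda>i. m i *s b i))"
  shows "splits \<Q> (lin_set c I b)"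
proof -
  have "splits \<Q> (\<Union> ((\<lambda>r. lin_set (c + lin_comb I b r) I (\<lambda>i. m i *s b i)) ` (\<Pi>\<^sub>E i\<in>I. {..<m i})))"
    by (rule splits_Union)
      (use assms(3) lin_set_scale(2)[where c = c, OF ind m] in \<open>auto intro!: finite_PiE\<close>)
  then show ?thesis by (simp only: lin_set_scale(1)[where c = c, OF ind m, symmetric])
qed

text \<open>
  Rescaling each generator by a suitable factor makes all non-zero values equal up to sign, with
  the product of their absolute values as common absolute value \<open>D\<close>.
\<close>

lemma splits_halfspace:
  assumes "free_linear (F :: (nat ^ 'd::finite) set)"
  shows "splits {{u. 0 \<le> affine_form a k u}} F"
proof -
  obtain c and I :: "'d set" and b where ind: "nat_independent I b" and F: "F = lin_set c I b"
    using assms unfolding free_linear_def by blast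
  define w where "w i = (if affine_form a 0 (b i) = 0 then 1 else nat \<bar>affine_form a 0 (b i)\<bar>)" for i
  define D where "D = (\<Prod>i\<in>I. w i)"
  define m where "m i = D div w i" for i
  have w: "w i > 0" for i by (simp add: w_def)
  then have D: "D > 0" by (simp add: D_def prod_pos)
  have dvd: "w i dvd D" if "i \<in> I" for i unfolding D_def using that by (intro dvd_prodI) auto
  have mw: "m i * w i = D" if "i \<in> I" for i using dvd[OF that] by (simp add: m_def)
  have m: "m i > 0" if "i \<in> I" for i using mw[OF that] D by (cases "m i") auto
  show ?thesis unfolding F
  proof (rule splits_scale[OF ind m])
    fix c
    show "splits {{u. 0 \<le> affine_form a k u}} (lin_set c I (\<lambda>i. m i *s b i))"
    proof (rule splits_halfspace_unit[where D = "int D"])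
      fix i assume i: "i \<in> I"
      have "affine_form a 0 (m i *s b i) = int (m i) * affine_form a 0 (b i)"
        by (simp add: affine_form_def sum_distrib_left algebra_simps)
      with mw[OF i] show "affine_form a 0 (m i *s b i) \<in> {- int D, 0, int D}"
        by (auto simp: w_def abs_if split: if_splits)
    qed (use D nat_independent_scale[OF ind m] in auto)
  qed
qed

text \<open>
  After multiplication of all generators by the modulus, the residue of the affine form depends
  only on the base point.
\<close>

lemma splits_congruence:
  assumes "free_linear (F :: (nat ^ 'd::finite) set)" "m > 0"
  shows "splits {{u. m dvd affine_form a k u}} F"
proof -
  obtain c and I :: "'d set" and b where ind: "nat_independent I b" and F: "F = lin_set c I b"
    using assms unfolding free_linear_def by blast
  have pos: "nat m > 0" using assms(2) by simp
  show ?thesis unfolding F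
  proof (rule splits_scale[OF ind pos])
    fix c
    have "m dvd affine_form a k (c + lin_comb I (\<lambda>i. nat m *s b i) n) \<longleftrightarrow> m dvd affine_form a k c" for n
    proof -
      have "affine_form a 0 (lin_comb I (\<lambda>i. nat m *s b i) n) =
          (\<Sum>i\<in>I. int (nat m * n i) * affine_form a 0 (b i))"
        unfolding lin_comb_scale by (rule affine_form_lin_comb)
      also have "\<dots> = m * (\<Sum>i\<in>I. int (n i) * affine_form a 0 (b i))"
        using assms(2) by (simp add: sum_distrib_left mult.assoc)
      finally show ?thesis by (simp add: affine_form_plus dvd_add_left_iff)
    qed
    then show "splits {{u. m dvd affine_form a k u}} (lin_set c I (\<lambda>i. nat m *s b i))"
      by (intro splits_const free_linear_lin_set nat_independent_scale ind pos) (auto simp: homogeneous_def lin_set_def)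
  qed
qed

theorem qf_set_splits:
  assumes "qf_set Q" "free_linear F"
  shows "splits {Q} F"
  using assms
proof (induction arbitrary: F)
  case (halfspace a c)
  then show ?case by (intro splits_halfspace)
next
  case (congruence m a c)
  then show ?case by (intro splits_congruence)
next
  case (compl S)
  then show ?case by (intro splits_Compl) auto
next
  case (inter S T)
  have "splits {S, T} F" by (rule splits_finite) (use inter in auto)
  then obtain \<F> where \<F>: "partition_into_free \<F> F" "\<And>G. G \<in> \<F> \<Longrightarrow> homogeneous S G \<and> homogeneous T G"
    by (auto simp: splits_def)
  have "homogeneous (S \<inter> T) G" if "G \<in> \<F>" for G
    using \<F>(2)[OF that] unfolding homogeneous_def by blast
  with \<F>(1) show ?case by (auto simp: splits_def)
qed

lemma free_linear_UNIV: "free_linear (UNIV :: (nat ^ 'd::finite) set)"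
proof -
  have comb: "lin_comb UNIV (\<lambda>i. axis i 1) n = (\<chi> i. n i)" for n :: "'d \<Rightarrow> nat"
    by (simp add: vec_eq_iff lin_comb_def axis_def if_distrib[of "\<lambda>x. _ * x"] cong: if_cong)
  have "nat_independent (UNIV :: 'd set) (\<lambda>i. axis i 1)"
    unfolding nat_independent_def comb by (auto simp: vec_eq_iff)
  moreover have "u \<in> lin_set 0 (UNIV :: 'd set) (\<lambda>i. axis i 1)" for u
    unfolding lin_set_def comb by (intro range_eqI[of _ _ "vec_nth u"]) (simp add: vec_eq_iff)
  ultimately show ?thesis unfolding free_linear_def by blast
qed

section \<open>Generating functions of free linear sets\<close>

definition xterm :: "nat ^ 'd \<Rightarrow> rat \<Rightarrow> (rat, 'd) mfps" where
  "xterm a r = mfps_of_poly (Poly_Mapping.single a r)"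

lemma mfps_nth_xterm: "mfps_nth (xterm a r) u = (if u = a then r else 0)"
  unfolding xterm_def by transfer (simp add: lookup_single when_def)

lemma mfps_nth_plus [simp]: "mfps_nth (f + g) u = mfps_nth f u + mfps_nth g u"
  by transfer simp

lemma mfps_nth_minus [simp]: "mfps_nth (f - g) u = mfps_nth f u - mfps_nth g u"
  by transfer simp

lemma mfps_nth_zero [simp]: "mfps_nth 0 u = 0"
  by transfer simp

lemma mfps_nth_one: "mfps_nth 1 u = (if u = 0 then 1 else 0)"
  by transfer simp

lemma mfps_nth_sum: "mfps_nth (\<Sum>a\<in>A. f a) u = (\<Sum>a\<in>A. mfps_nth (f a) u)"
  by (induction A rule: infinite_finite_induct) auto

lemma mfps_nth_times:
  "mfps_nth (f * g) u = (\<Sum>(a, c)\<in>{(a, c). a + c = u}. mfps_nth f a * mfps_nth g c)"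
  by transfer simp

lemma mfps_nth_xterm_times:
  fixes a :: "nat ^ 'd::finite"
  shows "mfps_nth (xterm a r * f) (a + v) = r * mfps_nth f v"
proof -
  have "mfps_nth (xterm a r * f) (a + v) =
      (\<Sum>(x, c)\<in>{(a, v)}. mfps_nth (xterm a r) x * mfps_nth f c)"
    unfolding mfps_nth_times
    by (rule sum.mono_neutral_right) (auto simp: finite_exponent_splits mfps_nth_xterm split: if_splits)
  then show ?thesis by (simp add: mfps_nth_xterm)
qed

lemma mfps_nth_xterm_times_eq_0:
  fixes a :: "nat ^ 'd::finite"
  assumes "\<And>v. u \<noteq> a + v"
  shows "mfps_nth (xterm a r * f) u = 0"
  unfolding mfps_nth_times
  by (rule sum.neutral) (use assms in \<open>auto simp: mfps_nth_xterm\<close>)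

lemma xterm_mult: "xterm (a :: nat ^ 'd::finite) r * xterm a' r' = xterm (a + a') (r * r')"
  unfolding mfps_eq_iff
proof
  fix u
  show "mfps_nth (xterm a r * xterm a' r') u = mfps_nth (xterm (a + a') (r * r')) u"
  proof (cases "\<exists>v. u = a + v")
    case True
    then show ?thesis by (auto simp: mfps_nth_xterm_times mfps_nth_xterm)
  next
    case False
    then show ?thesis by (auto simp: mfps_nth_xterm_times_eq_0 mfps_nth_xterm)
  qed
qed

lemma xterm_0_1: "xterm 0 1 = 1"
  by (simp add: mfps_eq_iff mfps_nth_xterm mfps_nth_one)

lemma geometric_inverse: "b \<noteq> 0 \<Longrightarrow> (1 - xterm b 1) * mfps_geometric (b :: nat ^ 'd::finite) = 1"
  unfolding xterm_def by (rule mfps_geometric_inverse)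

lemma eq_geometric_times:
  fixes b :: "nat ^ 'd::finite"
  assumes "b \<noteq> 0" "(1 - xterm b 1) * f = g" shows "f = mfps_geometric b * g"
proof -
  have "mfps_geometric b * g = (1 - xterm b 1) * mfps_geometric b * f"
    unfolding assms(2)[symmetric] by (simp only: mult_ac)
  then show ?thesis using geometric_inverse[OF assms(1)] by simp
qed

text \<open>\<open>multichoose k n\<close> is the coefficient of \<open>t\<^sup>n\<close> in \<open>(1 - t)\<^sup>-\<^sup>k\<close>; the truncated
  subtraction makes this right for \<open>k = 0\<close> as well.\<close>

definition multichoose :: "nat \<Rightarrow> nat \<Rightarrow> rat" where
  "multichoose k n = of_nat ((n + k - 1) choose n)"

lemma multichoose_0: "multichoose 0 n = (if n = 0 then 1 else 0)"
  by (simp add: multichoose_def)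

lemma multichoose_0_right [simp]: "multichoose k 0 = 1"
  by (simp add: multichoose_def)

lemma multichoose_1: "multichoose (Suc 0) n = 1"
  by (simp add: multichoose_def)

lemma multichoose_Suc_Suc: "multichoose (Suc k) (Suc n) = multichoose (Suc k) n + multichoose k (Suc n)"
  by (simp add: multichoose_def)

lemma lin_comb_eq_0_iff:
  assumes "nat_independent B b"
  shows "lin_comb B b n = 0 \<longleftrightarrow> (\<forall>i\<in>B. n i = 0)"
proof
  assume "lin_comb B b n = 0"
  then have "lin_comb B b n = lin_comb B b (\<lambda>_. 0)" by (simp add: lin_comb_def)
  then show "\<forall>i\<in>B. n i = 0" using nat_independentD[OF assms] by blast
qed (simp add: lin_comb_def)

lemma lin_comb_single:
  assumes "finite I" "i \<in> I" shows "lin_comb I b (\<lambda>k. if k = i then 1 else 0) = b i"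
proof -
  have "lin_comb I b (\<lambda>k. if k = i then 1 else 0) = (\<Sum>k\<in>I. if k = i then b k else 0)"
    unfolding lin_comb_def by (rule sum.cong) (auto simp: vec_eq_iff)
  then show ?thesis using assms by simp
qed

lemma independent_nonzero:
  assumes "nat_independent B b" "finite B" "i \<in> B" shows "b i \<noteq> 0"
proof
  assume "b i = 0"
  then have "lin_comb B b (\<lambda>j. if j = i then 1 else 0) = 0"
    by (simp only: lin_comb_single[OF assms(2,3)])
  then show False using lin_comb_eq_0_iff[OF assms(1)] assms(3) by force
qed

text \<open>
  Independence of the exponents makes the coefficient a product over the distinct factors. The
  induction adds one factor \<open>1 / (1 - x\<^sup>b)\<close>: the claimed series, multiplied by \<open>1 - x\<^sup>b\<close>, has the
  coefficients of the smaller product by the recursion of Pascal's triangle.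
\<close>

lemma geometric_prod_coeff:
  fixes B :: "(nat ^ 'd::finite) set"
  assumes fin: "finite B" and ind: "nat_independent B (\<lambda>b. b)" and "set_mset M \<subseteq> B"
  shows "mfps_nth (\<Prod>b\<in>#M. mfps_geometric b) (lin_comb B (\<lambda>b. b) n) =
      (\<Prod>b\<in>B. multichoose (count M b) (n b))"
    and "u \<notin> range (lin_comb B (\<lambda>b. b)) \<Longrightarrow> mfps_nth (\<Prod>b\<in>#M. mfps_geometric b :: (rat, 'd) mfps) u = 0"
proof -
  let ?L = "lin_comb B (\<lambda>b. b)"
  have "(\<forall>n. mfps_nth (\<Prod>b\<in>#M. mfps_geometric b) (?L n) = (\<Prod>b\<in>B. multichoose (count M b) (n b))) \<and>
      (\<forall>u. u \<notin> range ?L \<longrightarrow> mfps_nth (\<Prod>b\<in>#M. mfps_geometric b :: (rat, 'd) mfps) u = 0)"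
    using assms(3)
  proof (induction M)
    case empty
    have "(\<Prod>b\<in>B. multichoose 0 (n b)) = (if ?L n = 0 then 1 else 0)" for n
    proof (cases "\<forall>b\<in>B. n b = 0")
      case True
      then show ?thesis using lin_comb_eq_0_iff[OF ind, of n] by (simp add: multichoose_0)
    next
      case False
      then have "(\<Prod>b\<in>B. multichoose 0 (n b)) = 0" using fin by (auto simp: multichoose_0)
      then show ?thesis using False lin_comb_eq_0_iff[OF ind, of n] by simp
    qed
    moreover have "u \<noteq> 0" if "u \<notin> range ?L" for u
    proof
      assume "u = 0"
      then have "u = ?L (\<lambda>_. 0)" by (simp add: lin_comb_def)
      then show False using that by blast
    qed
    ultimately show ?case by (simp add: mfps_nth_one)
  next
    case (add b M)
    then have b: "b \<in> B" and sub: "set_mset M \<subseteq> B" by auto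
    let ?P = "\<Prod>b\<in>#M. mfps_geometric b :: (rat, 'd) mfps"
    have IH: "mfps_nth ?P (?L n) = (\<Prod>b\<in>B. multichoose (count M b) (n b))"
      "u \<notin> range ?L \<Longrightarrow> mfps_nth ?P u = 0" for n u
      using add.IH[OF sub] by blast+
    let ?k = "count (add_mset b M)"
    \<comment> \<open>The claimed series \<open>f\<close> is defined through the coordinates \<open>\<nu>\<close>, which independence makes
      well defined on the points of the linear set.\<close>
    define \<nu> where "\<nu> u = (SOME n. u = ?L n)" for u
    have \<nu>: "\<nu> (?L n) c = n c" if "c \<in> B" for n c
    proof -
      have "?L n = ?L (\<nu> (?L n))" unfolding \<nu>_def by (rule someI[of _ n]) simp
      from nat_independentD[OF ind this that] show ?thesis by simp
    qed
    define f where "f = Abs_mfps (\<lambda>u. if u \<in> range ?L then \<Prod>c\<in>B. multichoose (?k c) (\<nu> u c) else 0)"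
    have f_out: "mfps_nth f u = 0" if "u \<notin> range ?L" for u
      using that by (simp add: f_def Abs_mfps_inverse)
    have f_in: "mfps_nth f (?L n) = (\<Prod>c\<in>B. multichoose (?k c) (n c))" for n
      by (simp add: f_def Abs_mfps_inverse \<nu>)
    have shift: "b + ?L n = ?L (n(b := Suc (n b)))" for n
      using lin_comb_Suc[OF fin b, of "\<lambda>b. b"] by simp
    have remove: "(\<Prod>c\<in>B. g c) = g b * (\<Prod>c\<in>B - {b}. g c)" for g :: "_ \<Rightarrow> rat"
      using fin b by (rule prod.remove)
    have rest: "(\<Prod>c\<in>B - {b}. multichoose (?k c) (n c)) = (\<Prod>c\<in>B - {b}. multichoose (count M c) (n c))" for n
      by (rule prod.cong) auto
    have rest': "(\<Prod>c\<in>B - {b}. multichoose (count M c) ((n(b := k)) c)) =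
        (\<Prod>c\<in>B - {b}. multichoose (count M c) (n c))" for n k
      by (rule prod.cong) auto
    have kb: "?k b = Suc (count M b)" by simp
    have "mfps_nth ((1 - xterm b 1) * f) u = mfps_nth ?P u" for u
    proof -
      have diff: "mfps_nth ((1 - xterm b 1) * f) u = mfps_nth f u - mfps_nth (xterm b 1 * f) u"
        by (simp add: left_diff_distrib)
      show ?thesis
      proof (cases "u \<in> range ?L")
        case False
        have "mfps_nth (xterm b 1 * f) u = 0"
        proof (cases "\<exists>v. u = b + v")
          case True
          then obtain v where v: "u = b + v" by blast
          then have "v \<notin> range ?L" using False shift by auto
          then show ?thesis unfolding v mfps_nth_xterm_times by (simp add: f_out)
        qed (simp add: mfps_nth_xterm_times_eq_0)
        then show ?thesis using False diff by (simp add: f_out IH)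
      next
        case True
        then obtain n where u: "u = ?L n" by blast
        show ?thesis
        proof (cases "n b")
          case 0
          have "mfps_nth (xterm b 1 * f) u = 0"
          proof (cases "\<exists>v. u = b + v")
            case True
            then obtain v where v: "u = b + v" by blast
            have "v \<notin> range ?L"
            proof
              assume "v \<in> range ?L"
              then obtain m where "v = ?L m" by blast
              then have "?L n = ?L (m(b := Suc (m b)))" using u v shift by simp
              from nat_independentD[OF ind this b] show False using 0 by simp
            qed
            then show ?thesis unfolding v mfps_nth_xterm_times by (simp add: f_out)
          qed (simp add: mfps_nth_xterm_times_eq_0)
          then show ?thesis using 0 unfolding diff unfolding u f_in IH(1) remove rest kb by simp
        next
          case (Suc k)
          have "u = b + ?L (n(b := k))" unfolding shift u by (rule lin_comb_cong) (use Suc in auto)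
          then have 1: "mfps_nth (xterm b 1 * f) u = mfps_nth f (?L (n(b := k)))"
            by (simp add: mfps_nth_xterm_times)
          show ?thesis
            unfolding diff 1 unfolding u f_in IH(1) remove rest rest' kb
            by (simp add: Suc multichoose_Suc_Suc algebra_simps)
        qed
      qed
    qed
    then have "(1 - xterm b 1) * f = ?P" by (simp add: mfps_eq_iff)
    moreover have "b \<noteq> 0" using independent_nonzero[OF ind fin b] by simp
    ultimately have "f = mfps_geometric b * ?P" by (intro eq_geometric_times)
    then have "(\<Prod>c\<in>#add_mset b M. mfps_geometric c) = f" by simp
    then show ?case using f_in f_out by simp
  qed
  then show "mfps_nth (\<Prod>b\<in>#M. mfps_geometric b) (?L n) = (\<Prod>b\<in>B. multichoose (count M b) (n b))"
    "u \<notin> range ?L \<Longrightarrow> mfps_nth (\<Prod>b\<in>#M. mfps_geometric b :: (rat, 'd) mfps) u = 0" by blast+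
qed

lemma mfps_nth_generating_function: "mfps_nth (generating_function S) u = (if u \<in> S then 1 else 0)"
  by transfer simp

lemma generating_function_lin_set:
  fixes b :: "'i \<Rightarrow> nat ^ 'd::finite"
  assumes ind: "nat_independent I b" and fin: "finite I"
  shows "generating_function (lin_set c I b) = xterm c 1 * (\<Prod>i\<in>I. mfps_geometric (b i))"
proof -
  have inj: "inj_on b I"
  proof (rule inj_onI)
    fix i j assume ij: "i \<in> I" "j \<in> I" "b i = b j"
    then have "lin_comb I b (\<lambda>k. if k = i then 1 else 0) = lin_comb I b (\<lambda>k. if k = j then 1 else 0)"
      by (simp only: lin_comb_single[OF fin])
    from nat_independentD[OF ind this ij(1)] show "i = j" by (simp split: if_splits)
  qed
  let ?B = "b ` I"
  have comb: "lin_comb ?B (\<lambda>b. b) n = lin_comb I b (\<lambda>i. n (b i))" for n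
    unfolding lin_comb_def by (simp add: sum.reindex[OF inj])
  have indB: "nat_independent ?B (\<lambda>b. b)"
    unfolding nat_independent_def comb using nat_independentD[OF ind] by blast
  have range: "range (lin_comb ?B (\<lambda>b. b)) = range (lin_comb I b)"
  proof
    show "range (lin_comb ?B (\<lambda>b. b)) \<subseteq> range (lin_comb I b)" unfolding comb by blast
    have "lin_comb I b n = lin_comb ?B (\<lambda>b. b) (\<lambda>v. n (inv_into I b v))" for n
      unfolding comb by (rule lin_comb_cong) (simp_all add: inj)
    then show "range (lin_comb I b) \<subseteq> range (lin_comb ?B (\<lambda>b. b))" by auto
  qed
  let ?M = "mset_set ?B"
  have P: "(\<Prod>i\<in>I. mfps_geometric (b i)) = (\<Prod>b\<in>#?M. mfps_geometric b :: (rat, 'd) mfps)"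
    unfolding prod_unfold_prod_mset[symmetric] by (simp add: prod.reindex[OF inj])
  have sub: "set_mset ?M \<subseteq> ?B" and finB: "finite ?B" using fin by simp_all
  have coeff: "mfps_nth (\<Prod>b\<in>#?M. mfps_geometric b :: (rat, 'd) mfps) v = (if v \<in> range (lin_comb I b) then 1 else 0)" for v
  proof (cases "v \<in> range (lin_comb I b)")
    case True
    then obtain n where v: "v = lin_comb ?B (\<lambda>b. b) n" unfolding range[symmetric] by blast
    have "mfps_nth (\<Prod>b\<in>#?M. mfps_geometric b :: (rat, 'd) mfps) v = 1"
      unfolding v geometric_prod_coeff(1)[OF finB indB sub]
      by (rule prod.neutral) (simp add: fin multichoose_1)
    then show ?thesis using True by simp
  next
    case False
    then show ?thesis using geometric_prod_coeff(2)[OF finB indB sub] range by simp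
  qed
  have "mfps_nth (generating_function (lin_set c I b)) u =
      mfps_nth (xterm c 1 * (\<Prod>i\<in>I. mfps_geometric (b i))) u" for u
  proof (cases "\<exists>v. u = c + v")
    case True
    then obtain v where v: "u = c + v" by blast
    have "u \<in> lin_set c I b \<longleftrightarrow> v \<in> range (lin_comb I b)" unfolding v lin_set_def by auto
    then show ?thesis unfolding v P mfps_nth_xterm_times coeff mfps_nth_generating_function by simp
  next
    case False
    then have "u \<notin> lin_set c I b" by (auto simp: lin_set_def)
    then show ?thesis using False by (simp add: mfps_nth_generating_function mfps_nth_xterm_times_eq_0)
  qed
  then show ?thesis by (simp add: mfps_eq_iff)
qed

text \<open>
  Working with finitely supported series instead of polynomial mappings avoids computing
  products of the latter.
\<close>

lemma mfps_of_poly_iff: "(\<exists>q. p = mfps_of_poly q) \<longleftrightarrow> finite {u. mfps_nth p u \<noteq> 0}"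
proof
  assume "\<exists>q. p = mfps_of_poly q"
  then obtain q where p: "p = mfps_of_poly q" by blast
  have "mfps_nth p u = Poly_Mapping.lookup q u" for u unfolding p by transfer simp
  then show "finite {u. mfps_nth p u \<noteq> 0}" by simp
next
  assume fin: "finite {u. mfps_nth p u \<noteq> 0}"
  have "p = mfps_of_poly (Abs_poly_mapping (mfps_nth p))"
    unfolding mfps_eq_iff mfps_of_poly.rep_eq by (simp add: Abs_poly_mapping_inverse fin)
  then show "\<exists>q. p = mfps_of_poly q" by blast
qed

lemma finite_support_add:
  assumes "finite {u. mfps_nth p u \<noteq> 0}" "finite {u. mfps_nth q u \<noteq> 0}"
  shows "finite {u. mfps_nth (p + q) u \<noteq> 0}"
  by (rule finite_subset[OF _ finite_UnI[OF assms]]) auto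

lemma finite_support_times:
  assumes "finite {u. mfps_nth p u \<noteq> 0}" "finite {u. mfps_nth q u \<noteq> 0}"
  shows "finite {u. mfps_nth (p * q) u \<noteq> 0}"
proof (rule finite_subset)
  let ?A = "{u. mfps_nth p u \<noteq> 0}" and ?B = "{u. mfps_nth q u \<noteq> 0}"
  show "finite ((\<lambda>(a, c). a + c) ` (?A \<times> ?B))" using assms by simp
  show "{u. mfps_nth (p * q) u \<noteq> 0} \<subseteq> (\<lambda>(a, c). a + c) ` (?A \<times> ?B)"
  proof
    fix u assume "u \<in> {u. mfps_nth (p * q) u \<noteq> 0}"
    then have "(\<Sum>(a, c)\<in>{(a, c). a + c = u}. mfps_nth p a * mfps_nth q c) \<noteq> 0"
      by (simp add: mfps_nth_times)
    then obtain x where x: "x \<in> {(a, c). a + c = u}" "(case x of (a, c) \<Rightarrow> mfps_nth p a * mfps_nth q c) \<noteq> 0"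
      by (rule sum.not_neutral_contains_not_neutral)
    then show "u \<in> (\<lambda>(a, c). a + c) ` (?A \<times> ?B)" by (intro image_eqI[of _ _ x]) auto
  qed
qed

lemma rational_gf_iff:
  "rational_gf f \<longleftrightarrow> (\<exists>p bs. finite {u. mfps_nth p u \<noteq> 0} \<and> 0 \<notin> set bs \<and>
     f = p * (\<Prod>b\<leftarrow>bs. mfps_geometric b))"
  unfolding rational_gf_def mfps_of_poly_iff[symmetric] by blast

lemma finite_support_xterm: "finite {u. mfps_nth (xterm a r) u \<noteq> 0}"
  by (rule finite_subset[of _ "{a}"]) (auto simp: mfps_nth_xterm)

lemma finite_support_one: "finite {u. mfps_nth (1 :: (rat, 'd::finite) mfps) u \<noteq> 0}"
  unfolding xterm_0_1[symmetric] by (rule finite_support_xterm)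

lemma ex_denominator:
  fixes bs :: "(nat ^ 'd::finite) list"
  assumes "0 \<notin> set bs"
  shows "\<exists>h. finite {u. mfps_nth h u \<noteq> 0} \<and> h * (\<Prod>b\<leftarrow>bs. mfps_geometric b) = (1 :: (rat, 'd) mfps)"
  using assms
proof (induction bs)
  case Nil
  then show ?case using finite_support_one by (intro exI[of _ 1]) simp
next
  case (Cons b bs)
  then obtain h where h: "finite {u. mfps_nth h u \<noteq> 0}"
    "h * (\<Prod>b\<leftarrow>bs. mfps_geometric b) = (1 :: (rat, 'd) mfps)" by auto
  have "finite {u. mfps_nth (1 + xterm b (- 1)) u \<noteq> 0}"
    using finite_support_add finite_support_one finite_support_xterm by blast
  then have "finite {u. mfps_nth ((1 + xterm b (- 1)) * h) u \<noteq> 0}"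
    using h(1) by (rule finite_support_times)
  moreover have "1 + xterm b (- 1) = 1 - xterm b 1" by (simp add: mfps_eq_iff mfps_nth_xterm)
  moreover have "(1 - xterm b 1) * h * (\<Prod>b\<leftarrow>b # bs. mfps_geometric b) =
      ((1 - xterm b 1) * mfps_geometric b) * (h * (\<Prod>b\<leftarrow>bs. mfps_geometric b))"
    by (simp add: mult_ac)
  ultimately show ?case using Cons.prems geometric_inverse[of b] h(2) by (intro exI[of _ "(1 - xterm b 1) * h"]) simp
qed

lemma rational_gf_add:
  assumes "rational_gf f" "rational_gf g" shows "rational_gf (f + g)"
proof -
  obtain p bs where f: "finite {u. mfps_nth p u \<noteq> 0}" "0 \<notin> set bs" "f = p * (\<Prod>b\<leftarrow>bs. mfps_geometric b)"
    using assms(1) unfolding rational_gf_iff by blast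
  obtain q cs where g: "finite {u. mfps_nth q u \<noteq> 0}" "0 \<notin> set cs" "g = q * (\<Prod>b\<leftarrow>cs. mfps_geometric b)"
    using assms(2) unfolding rational_gf_iff by blast
  obtain h where h: "finite {u. mfps_nth h u \<noteq> 0}" "h * (\<Prod>b\<leftarrow>bs. mfps_geometric b) = (1 :: (rat, 'a) mfps)"
    using ex_denominator[OF f(2)] by blast
  obtain k where k: "finite {u. mfps_nth k u \<noteq> 0}" "k * (\<Prod>b\<leftarrow>cs. mfps_geometric b) = (1 :: (rat, 'a) mfps)"
    using ex_denominator[OF g(2)] by blast
  have "(p * k + q * h) * (\<Prod>b\<leftarrow>bs @ cs. mfps_geometric b) =
      p * (\<Prod>b\<leftarrow>bs. mfps_geometric b) * (k * (\<Prod>b\<leftarrow>cs. mfps_geometric b)) +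
      q * (\<Prod>b\<leftarrow>cs. mfps_geometric b) * (h * (\<Prod>b\<leftarrow>bs. mfps_geometric b))"
    by (simp add: algebra_simps)
  then have "f + g = (p * k + q * h) * (\<Prod>b\<leftarrow>bs @ cs. mfps_geometric b)"
    by (simp only: h(2) k(2) f(3) g(3) mult_1_right)
  moreover have "finite {u. mfps_nth (p * k + q * h) u \<noteq> 0}"
    by (intro finite_support_add finite_support_times f g h k)
  moreover have "0 \<notin> set (bs @ cs)" using f(2) g(2) by simp
  ultimately show ?thesis unfolding rational_gf_iff by blast
qed

lemma rational_gf_0: "rational_gf 0"
  unfolding rational_gf_iff by (intro exI[of _ 0] exI[of _ "[]"]) simp

lemma rational_gf_free_linear:
  assumes "free_linear (F :: (nat ^ 'd::finite) set)" shows "rational_gf (generating_function F)"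
proof -
  obtain c and I :: "'d set" and b where ind: "nat_independent I b" and F: "F = lin_set c I b"
    using assms unfolding free_linear_def by blast
  obtain js where js: "set js = I" "distinct js" using finite_distinct_list[of I] by auto
  have "(\<Prod>i\<in>I. mfps_geometric (b i)) = (\<Prod>v\<leftarrow>map b js. mfps_geometric v :: (rat, 'd) mfps)"
    unfolding js(1)[symmetric] by (simp add: prod.distinct_set_conv_list[OF js(2)] comp_def)
  moreover have "0 \<notin> set (map b js)" using independent_nonzero[OF ind] js(1) by auto
  ultimately show ?thesis
    unfolding rational_gf_iff F generating_function_lin_set[OF ind finite]
    by (intro exI[of _ "xterm c 1"] exI[of _ "map b js"] conjI finite_support_xterm) simp_all
qed

lemma rational_gf_disjoint_Union:
  fixes \<F> :: "(nat ^ 'd::finite) set set"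
  assumes "finite \<F>" "disjoint \<F>" "\<And>F. F \<in> \<F> \<Longrightarrow> rational_gf (generating_function F)"
  shows "rational_gf (generating_function (\<Union>\<F>))"
  using assms
proof (induction \<F>)
  case empty
  have "generating_function ({} :: (nat ^ 'd) set) = 0" by (simp add: mfps_eq_iff mfps_nth_generating_function)
  then show ?case by (simp add: rational_gf_0)
next
  case (insert F \<F>)
  have "F \<inter> G = {}" if "G \<in> \<F>" for G
    using insert.prems(1) insert.hyps(2) that by (auto simp: disjoint_def)
  then have "F \<inter> \<Union>\<F> = {}" by blast
  then have "generating_function (\<Union> (insert F \<F>)) = generating_function F + generating_function (\<Union>\<F>)"
    by (auto simp: mfps_eq_iff mfps_nth_generating_function)
  moreover have "disjoint \<F>" using insert.prems(1) by (simp add: disjoint_def)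
  ultimately show ?case using insert by (simp add: rational_gf_add)
qed

theorem presburger_imp_rational_gf:
  fixes S :: "(nat ^ 'd::finite) set"
  assumes "presburger_set S"
  shows "rational_gf (generating_function S)"
proof -
  obtain \<F> where \<F>: "partition_into_free \<F> UNIV" "\<And>G. G \<in> \<F> \<Longrightarrow> homogeneous S G"
    using qf_set_splits[OF presburger_imp_qf_set[OF assms] free_linear_UNIV] by (auto simp: splits_def)
  have "S = \<Union> {G \<in> \<F>. G \<subseteq> S}" using \<F> by (rule homogeneous_partition_Union)
  moreover have "rational_gf (generating_function (\<Union> {G \<in> \<F>. G \<subseteq> S}))"
    by (rule rational_gf_disjoint_Union)
      (use \<F>(1) rational_gf_free_linear in \<open>auto simp: partition_into_free_def disjoint_def\<close>)
  ultimately show ?thesis by simp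
qed

section \<open>Partial fractions with independent denominators\<close>

text \<open>
  Sums of fractions \<open>r x\<^sup>a / \<Prod> (1 - x\<^sup>b)\<close> whose denominators have independent exponents, with
  repeated factors allowed.
\<close>

inductive fraction_sum :: "(rat, 'd::finite) mfps \<Rightarrow> bool" where
  fraction: "nat_independent (set_mset M) (\<lambda>b. b) \<Longrightarrow> fraction_sum (xterm a r * (\<Prod>b\<in>#M. mfps_geometric b))"
| add: "fraction_sum f \<Longrightarrow> fraction_sum g \<Longrightarrow> fraction_sum (f + g)"

text \<open>
  The series that preserve sums of fractions. Monomials are among them, and they are closed under
  sums and products; so polynomial factors that arise in a rewriting step can stay unexpanded.
\<close>

definition multiplier :: "(rat, 'd::finite) mfps \<Rightarrow> bool" where
  "multiplier c \<longleftrightarrow> (\<forall>f. fraction_sum f \<longrightarrow> fraction_sum (c * f))"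

lemma xterm_0 [simp]: "xterm a 0 = 0"
  by (simp add: mfps_eq_iff mfps_nth_xterm)

lemma fraction_sum_0: "fraction_sum 0"
proof -
  have "nat_independent (set_mset {#}) (\<lambda>b :: nat ^ 'a. b)" by (simp add: nat_independent_def)
  from fraction_sum.fraction[OF this, of 0 0] show ?thesis by simp
qed

lemma fraction_sum_sum:
  "(\<And>i. i \<in> A \<Longrightarrow> fraction_sum (f i)) \<Longrightarrow> fraction_sum (\<Sum>i\<in>A. f i)"
  by (induction A rule: infinite_finite_induct) (auto simp: fraction_sum_0 fraction_sum.add)

lemma multiplierD: "multiplier c \<Longrightarrow> fraction_sum f \<Longrightarrow> fraction_sum (c * f)"
  by (simp add: multiplier_def)

lemma multiplier_xterm: "multiplier (xterm a r)"
proof -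
  have "fraction_sum (xterm a r * f)" if "fraction_sum f" for f
    using that
  proof induction
    case (fraction M a' r')
    from fraction_sum.fraction[OF this, of "a + a'" "r * r'"]
    show ?case by (simp add: mult.assoc[symmetric] xterm_mult)
  next
    case (add f g)
    then show ?case by (simp add: distrib_left fraction_sum.add)
  qed
  then show ?thesis by (simp add: multiplier_def)
qed

lemma multiplier_add: "multiplier c \<Longrightarrow> multiplier d \<Longrightarrow> multiplier (c + d)"
  by (simp add: multiplier_def distrib_right fraction_sum.add)

lemma multiplier_mult: "multiplier c \<Longrightarrow> multiplier d \<Longrightarrow> multiplier (c * d)"
  by (simp add: multiplier_def mult.assoc)

lemma multiplier_1: "multiplier 1"
  by (simp add: multiplier_def)

lemma multiplier_power: "multiplier c \<Longrightarrow> multiplier (c ^ k)"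
  by (induction k) (auto simp: multiplier_1 multiplier_mult)

lemma multiplier_sum: "(\<And>i. i \<in> A \<Longrightarrow> multiplier (c i)) \<Longrightarrow> multiplier (\<Sum>i\<in>A. c i)"
  by (simp add: multiplier_def sum_distrib_right fraction_sum_sum)

lemma multiplier_diff:
  fixes c d :: "(rat, 'd::finite) mfps"
  assumes "multiplier c" "multiplier d" shows "multiplier (c - d)"
proof -
  have "xterm 0 (- 1) = (- 1 :: (rat, 'd) mfps)" by (simp add: mfps_eq_iff mfps_nth_xterm mfps_nth_one uminus_mfps.rep_eq)
  then have "c - d = c + xterm 0 (- 1) * d" by simp
  then show ?thesis
    by (simp only: multiplier_add[OF assms(1) multiplier_mult[OF multiplier_xterm assms(2)]])
qed

lemma multiplier_finite_support:
  assumes "finite {u. mfps_nth p u \<noteq> 0}" shows "multiplier p"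
proof -
  let ?A = "{u. mfps_nth p u \<noteq> 0}"
  have "p = (\<Sum>a\<in>?A. xterm a (mfps_nth p a))"
    unfolding mfps_eq_iff mfps_nth_sum mfps_nth_xterm using assms by simp
  moreover have "multiplier (\<Sum>a\<in>?A. xterm a (mfps_nth p a))"
    by (intro multiplier_sum multiplier_xterm)
  ultimately show ?thesis by simp
qed

lemma xterm_power: "xterm (k *s b) 1 = xterm (b :: nat ^ 'd::finite) 1 ^ k"
proof (induction k)
  case 0
  then show ?case by (simp add: xterm_0_1)
next
  case (Suc k)
  have "Suc k *s b = b + k *s b" by (simp add: vec_eq_iff)
  then show ?case using Suc xterm_mult[of b 1 "k *s b" 1] by simp
qed

text \<open>
  A telescoping argument: \<open>1 - x\<^sup>w\<^sup>+\<^sup>v = (1 - x\<^sup>w) + x\<^sup>w (1 - x\<^sup>v)\<close>, and \<open>1 - x\<^sup>p\<^sup>b\<close> is a multiple of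
  \<open>1 - x\<^sup>b\<close>.
\<close>

lemma one_minus_xterm_in_ideal:
  fixes A :: "(nat ^ 'd::finite) set"
  assumes "finite A"
  shows "\<exists>c. (\<forall>b\<in>A. multiplier (c b)) \<and>
    1 - xterm (lin_comb A (\<lambda>b. b) p) 1 = (\<Sum>b\<in>A. c b * (1 - xterm b 1))"
  using assms
proof (induction A)
  case empty
  then show ?case by (simp add: lin_comb_def xterm_0_1)
next
  case (insert b A)
  let ?w = "lin_comb A (\<lambda>b. b) p"
  obtain c where c: "\<forall>b\<in>A. multiplier (c b)" "1 - xterm ?w 1 = (\<Sum>b\<in>A. c b * (1 - xterm b 1))"
    using insert.IH by blast
  define s where "s = xterm ?w 1 * (\<Sum>i<p b. xterm b 1 ^ i)"
  have w: "lin_comb (insert b A) (\<lambda>b. b) p = ?w + p b *s b"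
    using insert.hyps by (simp add: lin_comb_def add.commute)
  have "1 - xterm (?w + p b *s b) 1 = (1 - xterm ?w 1) + xterm ?w 1 * (1 - xterm b 1 ^ p b)"
    using xterm_mult[of ?w 1 "p b *s b" 1] by (simp add: xterm_power algebra_simps)
  also have "1 - xterm b 1 ^ p b = (1 - xterm b 1) * (\<Sum>i<p b. xterm b 1 ^ i)"
    by (rule one_diff_power_eq)
  also have "(1 - xterm ?w 1) + xterm ?w 1 * ((1 - xterm b 1) * (\<Sum>i<p b. xterm b 1 ^ i)) =
      (\<Sum>a\<in>A. c a * (1 - xterm a 1)) + s * (1 - xterm b 1)"
    unfolding c(2) s_def by (simp only: mult_ac)
  also have "(\<Sum>a\<in>A. c a * (1 - xterm a 1)) = (\<Sum>a\<in>A. (c(b := s)) a * (1 - xterm a 1))"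
    by (rule sum.cong) (use insert.hyps in auto)
  also have "\<dots> + s * (1 - xterm b 1) = (\<Sum>a\<in>insert b A. (c(b := s)) a * (1 - xterm a 1))"
    using insert.hyps by (simp add: add.commute)
  finally have "1 - xterm (lin_comb (insert b A) (\<lambda>b. b) p) 1 =
      (\<Sum>a\<in>insert b A. (c(b := s)) a * (1 - xterm a 1))" unfolding w .
  moreover have "multiplier s"
    unfolding s_def by (intro multiplier_mult multiplier_sum multiplier_power multiplier_xterm)
  then have "\<forall>a\<in>insert b A. multiplier ((c(b := s)) a)" using c(1) by simp
  ultimately show ?case by blast
qed

text \<open>
  The common part of the two coefficient vectors is cancelled, which separates their supports. The
  coefficient vectors that remain cannot vanish on one side only, since a non-trivial sum of
  non-zero vectors with natural entries is not zero.
\<close>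

lemma nat_dependentE:
  fixes B :: "(nat ^ 'd::finite) set"
  assumes "finite B" "0 \<notin> B" "\<not> nat_independent B (\<lambda>b. b)"
  obtains p q b where "lin_comb B (\<lambda>b. b) p = lin_comb B (\<lambda>b. b) q" "b \<in> B" "p b > 0" "q b = 0"
proof -
  let ?L = "lin_comb B (\<lambda>b. b)"
  obtain n m b where nm: "?L n = ?L m" and b: "b \<in> B" "n b \<noteq> m b"
    using assms(3) unfolding nat_independent_def by blast
  let ?p = "\<lambda>b. n b - m b" and ?q = "\<lambda>b. m b - n b" and ?min = "\<lambda>b. min (n b) (m b)"
  have "(\<lambda>b. ?p b + ?min b) = n" "(\<lambda>b. ?q b + ?min b) = m" by (auto simp: fun_eq_iff)
  then have "?L ?p + ?L ?min = ?L ?q + ?L ?min" unfolding lin_comb_add using nm by simp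
  then have eq: "?L ?p = ?L ?q" by simp
  have "\<exists>c\<in>B. ?p c > 0"
  proof (rule ccontr)
    assume "\<not> (\<exists>c\<in>B. ?p c > 0)"
    then have p: "?p c = 0" if "c \<in> B" for c using bspec[of B "\<lambda>c. \<not> ?p c > 0", OF _ that] by simp
    then have "?L ?p = 0" unfolding lin_comb_def by (intro sum.neutral) auto
    then have "?q b *s b + lin_comb (B - {b}) (\<lambda>b. b) ?q = 0"
      using eq lin_comb_remove[OF assms(1) b(1), of "\<lambda>b. b" ?q] by simp
    then have "?q b *s b = 0" by (simp add: vec_eq_iff)
    moreover have "?q b > 0" using p[OF b(1)] b(2) by simp
    ultimately have "b = 0" by (simp add: vec_eq_iff)
    then show False using assms(2) b(1) by simp
  qed
  then obtain c where "c \<in> B" "?p c > 0" by blast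
  then show thesis using that[OF eq, of c] by simp
qed

text \<open>
  Expanding \<open>1 / P = (1 - x\<^sup>z) / ((1 - x\<^sup>z) P)\<close> by means of the relation cancels, in every summand, one
  factor other than \<open>1 - x\<^sup>z\<close> of the denominator, at the cost of a higher power of \<open>1 - x\<^sup>z\<close>. This
  ends when one of the exponents in \<open>B\<close> has disappeared.
\<close>

lemma fraction_sum_reduce:
  fixes B :: "(nat ^ 'd::finite) set"
  assumes B: "finite B" "z \<notin> B" "0 \<notin> insert z B"
    and c: "\<And>b. b \<in> B \<Longrightarrow> multiplier (c b)"
    and rel: "1 - xterm z 1 = (\<Sum>b\<in>B. c b * (1 - xterm b 1))"
    and smaller: "\<And>N. set_mset N \<subset> insert z B \<Longrightarrow> fraction_sum (\<Prod>b\<in>#N. mfps_geometric b)"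
    and "set_mset N \<subseteq> insert z B"
  shows "fraction_sum (\<Prod>b\<in>#N. mfps_geometric b)"
  using assms(7)
proof (induction "size (filter_mset (\<lambda>b. b \<noteq> z) N)" arbitrary: N rule: less_induct)
  case less
  show ?case
  proof (cases "set_mset N = insert z B")
    case False
    then show ?thesis using less.prems by (intro smaller) auto
  next
    case True
    let ?P = "\<lambda>N. \<Prod>b\<in>#N. mfps_geometric b :: (rat, 'd) mfps"
    have cancel: "(1 - xterm b 1) * ?P N = ?P (N - {#b#})" if "b \<in> B" for b
    proof -
      have "b \<in># N" using True that by simp
      then obtain N' where N': "N = add_mset b N'" by (rule mset_add)
      then have "?P N = mfps_geometric b * ?P (N - {#b#})" by simp
      moreover have "b \<noteq> 0" using B(3) that by auto
      ultimately show ?thesis using geometric_inverse[of b] by (simp add: mult.assoc[symmetric])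
    qed
    have "z \<noteq> 0" using B(3) by auto
    then have "?P N = mfps_geometric z * ((1 - xterm z 1) * ?P N)"
      by (intro eq_geometric_times) simp_all
    also have "\<dots> = (\<Sum>b\<in>B. c b * (mfps_geometric z * ((1 - xterm b 1) * ?P N)))"
      unfolding rel by (simp add: sum_distrib_left sum_distrib_right mult_ac)
    also have "\<dots> = (\<Sum>b\<in>B. c b * ?P (add_mset z (N - {#b#})))"
      by (rule sum.cong) (simp_all add: cancel)
    finally have eq: "?P N = (\<Sum>b\<in>B. c b * ?P (add_mset z (N - {#b#})))" .
    have "fraction_sum (?P (add_mset z (N - {#b#})))" if b: "b \<in> B" for b
    proof (rule less.hyps)
      have bN: "b \<in># N" "b \<noteq> z" using True b B(2) by auto
      obtain N' where N': "N = add_mset b N'" using bN(1) by (rule mset_add)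
      show "size (filter_mset (\<lambda>b. b \<noteq> z) (add_mset z (N - {#b#}))) < size (filter_mset (\<lambda>b. b \<noteq> z) N)"
        using bN(2) by (simp add: N')
      show "set_mset (add_mset z (N - {#b#})) \<subseteq> insert z B"
        using less.prems by (auto dest: in_diffD)
    qed
    then show ?thesis unfolding eq by (intro fraction_sum_sum multiplierD c)
  qed
qed

text \<open>
  Induction on the number of distinct exponents. A dependence between them has the form
  \<open>p b b + \<Sum> p a a = \<Sum> q a a\<close> with \<open>p b > 0\<close> and sums over the exponents \<open>a \<noteq> b\<close>. With \<open>z = p b b\<close> it
  expresses \<open>1 - x\<^sup>z\<close> through the factors \<open>1 - x\<^sup>a\<close>; and \<open>1 / (1 - x\<^sup>b)\<close> is a polynomial multiple
  of \<open>1 / (1 - x\<^sup>z)\<close>, so \<open>b\<close> may be replaced by \<open>z\<close> and one of the exponents eliminated.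
\<close>

lemma fraction_sum_geometric_prod:
  assumes "0 \<notin># M"
  shows "fraction_sum (\<Prod>b\<in>#M. mfps_geometric (b :: nat ^ 'd::finite))"
  using assms
proof (induction "card (set_mset M)" arbitrary: M rule: less_induct)
  case less
  let ?P = "\<lambda>N. \<Prod>b\<in>#N. mfps_geometric b :: (rat, 'd) mfps"
  let ?B = "set_mset M"
  show ?case
  proof (cases "nat_independent ?B (\<lambda>b. b)")
    case True
    from fraction_sum.fraction[OF this, of 0 1] show ?thesis by (simp add: xterm_0_1)
  next
    case False
    obtain p q b where pq: "lin_comb ?B (\<lambda>b. b) p = lin_comb ?B (\<lambda>b. b) q" "b \<in> ?B" "p b > 0" "q b = 0"
      using nat_dependentE[OF _ less.prems False] by auto
    define B where "B = ?B - {b}"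
    define z where "z = p b *s b"
    have b0: "b \<noteq> 0" using pq(2) less.prems by auto
    have z0: "z \<noteq> 0" using b0 pq(3) by (auto simp: z_def vec_eq_iff)
    have finB: "finite B" and cardB: "card B < card ?B"
      using card_Diff1_less[OF finite_set_mset pq(2)] by (simp_all add: B_def)
    let ?L = "lin_comb B (\<lambda>b. b)"
    have rel0: "z + ?L p = ?L q"
      using pq lin_comb_remove[of ?B b "\<lambda>b. b" p] lin_comb_remove[of ?B b "\<lambda>b. b" q]
      by (simp add: B_def z_def)
    obtain c where c: "\<forall>b\<in>B. multiplier (c b)" "1 - xterm (?L p) 1 = (\<Sum>b\<in>B. c b * (1 - xterm b 1))"
      using one_minus_xterm_in_ideal[OF finB] by blast
    obtain d where d: "\<forall>b\<in>B. multiplier (d b)" "1 - xterm (?L q) 1 = (\<Sum>b\<in>B. d b * (1 - xterm b 1))"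
      using one_minus_xterm_in_ideal[OF finB] by blast
    have "1 - xterm z 1 = (1 - xterm (?L q) 1) - xterm z 1 * (1 - xterm (?L p) 1)"
      unfolding rel0[symmetric] using xterm_mult[of z 1 "?L p" 1] by (simp add: algebra_simps)
    also have "\<dots> = (\<Sum>b\<in>B. (d b - xterm z 1 * c b) * (1 - xterm b 1))"
      unfolding c(2) d(2) by (simp add: sum_distrib_left sum_subtractf left_diff_distrib mult.assoc)
    finally have rel: "1 - xterm z 1 = (\<Sum>b\<in>B. (d b - xterm z 1 * c b) * (1 - xterm b 1))" .
    \<comment> \<open>If \<open>z\<close> already occurs among the other exponents, replacing \<open>b\<close> by \<open>z\<close> reduces their number
      at once; otherwise the relation is needed.\<close>
    have reduced: "fraction_sum (?P N)" if N: "set_mset N \<subseteq> insert z B" for N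
    proof -
      have nz: "0 \<notin> insert z B" using z0 less.prems by (simp add: B_def)
      have card_le: "card (insert z B) \<le> card ?B" using cardB finB by (simp add: card_insert_if)
      show ?thesis
      proof (cases "z \<in> B")
        case True
        then have "insert z B = B" by blast
        then have "card (set_mset N) < card ?B"
          using N cardB card_mono[OF finB, of "set_mset N"] by simp
        then show ?thesis using N nz by (intro less.hyps) auto
      next
        case False
        show ?thesis
        proof (rule fraction_sum_reduce[OF finB False nz _ rel _ N])
          show "multiplier (d b - xterm z 1 * c b)" if "b \<in> B" for b
            using c(1) d(1) that by (intro multiplier_diff multiplier_mult multiplier_xterm) auto
          show "fraction_sum (?P N)" if "set_mset N \<subset> insert z B" for N
          proof (rule less.hyps)
            have "card (set_mset N) < card (insert z B)" using that finB by (intro psubset_card_mono) auto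
            then show "card (set_mset N) < card ?B" using card_le by simp
            show "0 \<notin># N" using that nz by blast
          qed
        qed
      qed
    qed
    define s where "s = (\<Sum>i<p b. xterm b 1 ^ i)"
    have "(1 - xterm b 1) * (s * mfps_geometric z) = (1 - xterm z 1) * mfps_geometric z"
      unfolding z_def xterm_power one_diff_power_eq s_def by (simp only: mult.assoc)
    then have Gb: "mfps_geometric b = s * mfps_geometric z"
      using eq_geometric_times[OF b0, of "s * mfps_geometric z" 1] geometric_inverse[OF z0] by simp
    let ?N = "replicate_mset (count M b) z + filter_mset (\<lambda>x. x \<noteq> b) M"
    have M: "M = replicate_mset (count M b) b + filter_mset (\<lambda>x. x \<noteq> b) M"
      by (auto simp: multiset_eq_iff)
    have "?P M = ?P (replicate_mset (count M b) b + filter_mset (\<lambda>x. x \<noteq> b) M)"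
      by (rule arg_cong[OF M])
    also have "\<dots> = mfps_geometric b ^ count M b * ?P (filter_mset (\<lambda>x. x \<noteq> b) M)" by simp
    also have "\<dots> = s ^ count M b * ?P ?N"
      unfolding Gb by (simp add: power_mult_distrib mult.assoc)
    finally have "?P M = s ^ count M b * ?P ?N" .
    moreover have "multiplier s"
      unfolding s_def by (intro multiplier_sum multiplier_power multiplier_xterm)
    moreover have "fraction_sum (?P ?N)"
      by (rule reduced) (auto simp: B_def split: if_splits)
    ultimately show ?thesis by (simp add: multiplierD multiplier_power)
  qed
qed

theorem rational_gf_imp_fraction_sum:
  assumes "rational_gf f" shows "fraction_sum f"
proof -
  obtain p bs where f: "finite {u. mfps_nth p u \<noteq> 0}" "0 \<notin> set bs" "f = p * (\<Prod>b\<leftarrow>bs. mfps_geometric b)"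
    using assms unfolding rational_gf_iff by blast
  have "(\<Prod>b\<leftarrow>bs. mfps_geometric b) = (\<Prod>b\<in>#mset bs. mfps_geometric b :: (rat, 'a) mfps)"
    by (simp flip: mset_map add: prod_mset_prod_list)
  then show ?thesis
    unfolding f(3) using f(2) by (simp add: multiplierD[OF multiplier_finite_support[OF f(1)]] fraction_sum_geometric_prod)
qed

section \<open>Rational generating functions with coefficients zero and one\<close>

lemma multichoose_poly: "\<exists>q. \<forall>n. multichoose (Suc k) n = poly q (of_nat n)"
proof (induction k)
  case 0
  then show ?case by (intro exI[of _ 1]) (simp add: multichoose_1)
next
  case (Suc k)
  then obtain q where q: "\<And>n. multichoose (Suc k) n = poly q (of_nat n)" by blast
  have "multichoose (Suc (Suc k)) n = poly (smult (1 / of_nat (Suc k)) ([:of_nat (Suc k), 1:] * q)) (of_nat n)" for n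
  proof -
    have choose: "multichoose (Suc j) n = of_nat ((n + j) choose j)" for j
      using binomial_symmetric[of n "n + j"] by (simp add: multichoose_def)
    have "Suc k * ((n + Suc k) choose Suc k) = Suc (n + k) * ((n + k) choose k)"
      using Suc_times_binomial[of k "n + k"] by simp
    then have "of_nat (Suc k) * multichoose (Suc (Suc k)) n = (of_nat (Suc k) + of_nat n) * multichoose (Suc k) n"
      unfolding choose of_nat_add[symmetric] of_nat_mult[symmetric] of_nat_eq_iff by (simp only: add.commute add_Suc_right)
    then show ?thesis unfolding q by (simp add: field_simps)
  qed
  then show ?case by blast
qed

lemma lin_comb_smult: "k *s lin_comb I b n = lin_comb I b (\<lambda>i. k * n i)"
  by (simp add: lin_comb_def vec_eq_iff sum_distrib_left mult.assoc)

lemma presburger_set_lin_set: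
  fixes c :: "nat ^ 'd::finite"
  assumes "finite I" shows "presburger_set (lin_set c I b)"
proof -
  have "lin_set c I b = {u. \<exists>n. \<forall>k. int (u $ k) = int_vec c $ k + (\<Sum>i\<in>I. int_vec (b i) $ k * int (n i))}"
  proof -
    have "u = c + lin_comb I b n \<longleftrightarrow>
        (\<forall>k. int (u $ k) = int_vec c $ k + (\<Sum>i\<in>I. int_vec (b i) $ k * int (n i)))" for u n
    proof -
      have "int ((c + lin_comb I b n) $ k) = int_vec c $ k + (\<Sum>i\<in>I. int_vec (b i) $ k * int (n i))" for k
        by (simp add: int_vec_def lin_comb_def mult.commute)
      then show ?thesis unfolding vec_eq_iff by (metis of_nat_eq_iff)
    qed
    then show ?thesis by (auto simp: lin_set_def)
  qed
  then show ?thesis using presburger_set_linear_image[OF assms] by simp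
qed

text \<open>
  The identity \<open>(u + t v) + t u = u + t (u + v)\<close> involves only sums of points of the ray, so it
  can be read off in the unique coefficients without subtraction.
\<close>

lemma lin_set_ray_affine:
  assumes ind: "nat_independent I b" and ray: "\<And>t. u + t *s v = a + lin_comb I b (\<nu> t)" and i: "i \<in> I"
  shows "of_nat (\<nu> t i) = (of_nat (\<nu> 0 i) + (of_nat (\<nu> 1 i) - of_nat (\<nu> 0 i)) * of_nat t :: rat)"
proof -
  let ?L = "lin_comb I b"
  have "(u + t *s v) + t *s (u + 0 *s v) = (u + 0 *s v) + t *s (u + 1 *s v)"
    by (simp add: vec_eq_iff algebra_simps)
  then have "(a + ?L (\<nu> t)) + t *s (a + ?L (\<nu> 0)) = (a + ?L (\<nu> 0)) + t *s (a + ?L (\<nu> 1))"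
    unfolding ray .
  then have "(a + t *s a) + (?L (\<nu> t) + t *s ?L (\<nu> 0)) = (a + t *s a) + (?L (\<nu> 0) + t *s ?L (\<nu> 1))"
    by (simp add: vec_eq_iff algebra_simps)
  then have "?L (\<lambda>i. \<nu> t i + t * \<nu> 0 i) = ?L (\<lambda>i. \<nu> 0 i + t * \<nu> 1 i)"
    by (simp add: lin_comb_smult lin_comb_add)
  from nat_independentD[OF ind this i] have "\<nu> t i + t * \<nu> 0 i = \<nu> 0 i + t * \<nu> 1 i" .
  from arg_cong[OF this, of "of_nat :: nat \<Rightarrow> rat"] show ?thesis by (simp add: algebra_simps)
qed

text \<open>
  The sets in \<open>\<Q>\<close> are the supports of the summands. On a ray inside a support the coordinates are
  affine in \<open>t\<close> and the coefficient is a polynomial in them; on a ray outside it is zero.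
\<close>

lemma fraction_sum_polynomial_on_rays:
  assumes "fraction_sum f"
  shows "\<exists>\<Q>. finite \<Q> \<and> (\<forall>Q\<in>\<Q>. presburger_set Q) \<and>
    (\<forall>u v. (\<forall>Q\<in>\<Q>. homogeneous Q (range (\<lambda>t. u + t *s v))) \<longrightarrow>
      (\<exists>q. \<forall>t. mfps_nth f (u + t *s v) = poly q (of_nat t)))"
  using assms
proof induction
  case (fraction M a r)
  let ?B = "set_mset M"
  let ?P = "\<Prod>b\<in>#M. mfps_geometric b :: (rat, 'a) mfps"
  let ?L = "lin_comb ?B (\<lambda>b. b)"
  let ?Q = "lin_set a ?B (\<lambda>b. b)"
  have "\<exists>q. \<forall>t. mfps_nth (xterm a r * ?P) (u + t *s v) = poly q (of_nat t)"
    if hom: "homogeneous ?Q (range (\<lambda>t. u + t *s v))" for u v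
  proof (cases "range (\<lambda>t. u + t *s v) \<subseteq> ?Q")
    case True
    then have "\<forall>t. \<exists>n. u + t *s v = a + ?L n" unfolding lin_set_def by blast
    from choice[OF this] obtain \<nu> where \<nu>: "\<And>t. u + t *s v = a + ?L (\<nu> t)" by blast
    \<comment> \<open>Every \<open>b \<in> ?B\<close> has positive multiplicity; for multiplicity \<open>0\<close> the function
      \<open>multichoose\<close> is not a polynomial.\<close>
    have "\<forall>b. \<exists>q. \<forall>n. multichoose (Suc (count M b - 1)) n = poly q (of_nat n)"
      by (intro allI multichoose_poly)
    from choice[OF this] obtain h where
      h: "\<And>b n. multichoose (Suc (count M b - 1)) n = poly (h b) (of_nat n)" by blast
    define \<alpha> where "\<alpha> b = (of_nat (\<nu> 0 b) :: rat)" for b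
    define \<delta> where "\<delta> b = of_nat (\<nu> 1 b) - (of_nat (\<nu> 0 b) :: rat)" for b
    let ?q = "smult r (\<Prod>b\<in>?B. pcompose (h b) [:\<alpha> b, \<delta> b:])"
    have "mfps_nth (xterm a r * ?P) (u + t *s v) = poly ?q (of_nat t)" for t
    proof -
      have "mfps_nth (xterm a r * ?P) (u + t *s v) = r * (\<Prod>b\<in>?B. multichoose (count M b) (\<nu> t b))"
        unfolding \<nu> mfps_nth_xterm_times geometric_prod_coeff(1)[OF finite_set_mset fraction subset_refl] ..
      also have "(\<Prod>b\<in>?B. multichoose (count M b) (\<nu> t b)) = (\<Prod>b\<in>?B. poly (h b) (\<alpha> b + \<delta> b * of_nat t))"
      proof (rule prod.cong)
        fix b assume b: "b \<in> ?B"
        then have "count M b = Suc (count M b - 1)" by simp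
        then have "multichoose (count M b) (\<nu> t b) = poly (h b) (of_nat (\<nu> t b))"
          using h[of b "\<nu> t b"] by simp
        then show "multichoose (count M b) (\<nu> t b) = poly (h b) (\<alpha> b + \<delta> b * of_nat t)"
          unfolding \<alpha>_def \<delta>_def lin_set_ray_affine[OF fraction \<nu> b, symmetric] .
      qed simp
      finally show ?thesis by (simp add: poly_prod poly_pcompose mult.commute)
    qed
    then show ?thesis by blast
  next
    case False
    then have out: "u + t *s v \<notin> ?Q" for t using hom unfolding homogeneous_def by blast
    have "mfps_nth (xterm a r * ?P) (u + t *s v) = 0" for t
    proof (cases "\<exists>w. u + t *s v = a + w")
      case True
      then obtain w where w: "u + t *s v = a + w" by blast
      have "w \<notin> range ?L" using out[of t] unfolding w lin_set_def by blast
      then show ?thesis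
        unfolding w mfps_nth_xterm_times
        using geometric_prod_coeff(2)[OF finite_set_mset fraction subset_refl] by simp
    qed (simp add: mfps_nth_xterm_times_eq_0)
    then show ?thesis by (intro exI[of _ 0]) simp
  qed
  then show ?case by (intro exI[of _ "{?Q}"]) (simp add: presburger_set_lin_set)
next
  case (add f g)
  obtain \<Q> where f: "finite \<Q>" "\<forall>Q\<in>\<Q>. presburger_set Q"
    "\<And>u v. \<forall>Q\<in>\<Q>. homogeneous Q (range (\<lambda>t. u + t *s v)) \<Longrightarrow>
      \<exists>q. \<forall>t. mfps_nth f (u + t *s v) = poly q (of_nat t)"
    using add.IH(1) by blast
  obtain \<Q>' where g: "finite \<Q>'" "\<forall>Q\<in>\<Q>'. presburger_set Q"
    "\<And>u v. \<forall>Q\<in>\<Q>'. homogeneous Q (range (\<lambda>t. u + t *s v)) \<Longrightarrow>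
      \<exists>q. \<forall>t. mfps_nth g (u + t *s v) = poly q (of_nat t)"
    using add.IH(2) by blast
  have "\<exists>q. \<forall>t. mfps_nth (f + g) (u + t *s v) = poly q (of_nat t)"
    if hom: "\<forall>Q\<in>\<Q> \<union> \<Q>'. homogeneous Q (range (\<lambda>t. u + t *s v))" for u v
  proof -
    obtain p where "\<forall>t. mfps_nth f (u + t *s v) = poly p (of_nat t)" using f(3)[of u v] hom by auto
    moreover obtain q where "\<forall>t. mfps_nth g (u + t *s v) = poly q (of_nat t)" using g(3)[of u v] hom by auto
    ultimately show ?thesis by (intro exI[of _ "p + q"]) simp
  qed
  moreover have "finite (\<Q> \<union> \<Q>')" "\<forall>Q\<in>\<Q> \<union> \<Q>'. presburger_set Q" using f g by auto
  ultimately show ?case by blast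
qed

lemma poly_two_valued_constant:
  fixes q :: "rat poly"
  assumes "\<And>t :: nat. poly q (of_nat t) = 0 \<or> poly q (of_nat t) = 1"
  shows "poly q (of_nat t) = poly q 0"
proof -
  have "range (of_nat :: nat \<Rightarrow> rat) \<subseteq> {x. poly (q * (q - 1)) x = 0}" using assms by auto
  moreover have "infinite (range (of_nat :: nat \<Rightarrow> rat))"
    by (rule range_inj_infinite) (simp add: inj_on_def)
  ultimately have "q * (q - 1) = 0" using poly_roots_finite[of "q * (q - 1)"] finite_subset by blast
  then have "q = 0 \<or> q = 1" by auto
  then show ?thesis by auto
qed

text \<open>
  On a piece of the partition all points are joined to the base point by rays in the directions of
  the generators, and membership in \<open>S\<close> is constant along these rays.
\<close>

theorem rational_gf_imp_presburger:
  fixes S :: "(nat ^ 'd::finite) set"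
  assumes "rational_gf (generating_function S)"
  shows "presburger_set S"
proof -
  let ?f = "generating_function S"
  obtain \<Q> where \<Q>: "finite \<Q>" "\<And>Q. Q \<in> \<Q> \<Longrightarrow> presburger_set Q"
    "\<And>u v. \<forall>Q\<in>\<Q>. homogeneous Q (range (\<lambda>t. u + t *s v)) \<Longrightarrow>
      \<exists>q. \<forall>t. mfps_nth ?f (u + t *s v) = poly q (of_nat t)"
    using fraction_sum_polynomial_on_rays[OF rational_gf_imp_fraction_sum[OF assms]] by blast
  have "splits \<Q> (UNIV :: (nat ^ 'd) set)"
    using \<Q>(1) by (rule splits_finite) (use \<Q>(2) presburger_imp_qf_set qf_set_splits free_linear_UNIV in blast)+
  then obtain \<F> where \<F>: "partition_into_free \<F> (UNIV :: (nat ^ 'd) set)"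
    "\<And>G Q. G \<in> \<F> \<Longrightarrow> Q \<in> \<Q> \<Longrightarrow> homogeneous Q G"
    by (auto simp: splits_def)
  have hom: "homogeneous S G" and pres: "presburger_set G" if G: "G \<in> \<F>" for G
  proof -
    have "free_linear G" using \<F>(1) G by (simp add: partition_into_free_def)
    then obtain c and I :: "'d set" and b where Geq: "G = lin_set c I b"
      unfolding free_linear_def by blast
    show "presburger_set G" unfolding Geq by (rule presburger_set_lin_set) simp
    have ray: "u + t *s b i \<in> S \<longleftrightarrow> u \<in> S" if u: "u \<in> G" and i: "i \<in> I" for u t i
    proof -
      obtain n where n: "u = c + lin_comb I b n" using u unfolding Geq lin_set_def by blast
      have in_G: "u + t *s b i \<in> G" for t
      proof -
        have "t *s b i = lin_comb I b (\<lambda>k. t * (if k = i then 1 else 0))"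
          unfolding lin_comb_smult[symmetric] lin_comb_single[OF finite i] ..
        then show ?thesis unfolding Geq n by (simp only: add.assoc lin_comb_add lin_set_memI)
      qed
      have "\<forall>Q\<in>\<Q>. homogeneous Q (range (\<lambda>t. u + t *s b i))"
      proof
        fix Q assume "Q \<in> \<Q>"
        with \<F>(2)[OF G] have "homogeneous Q G" .
        moreover have "range (\<lambda>t. u + t *s b i) \<subseteq> G" using in_G by blast
        ultimately show "homogeneous Q (range (\<lambda>t. u + t *s b i))" unfolding homogeneous_def by blast
      qed
      from \<Q>(3)[OF this] obtain q where q: "\<And>t. mfps_nth ?f (u + t *s b i) = poly q (of_nat t)" by blast
      have "poly q (of_nat t) = 0 \<or> poly q (of_nat t) = 1" for t :: nat
        unfolding q[symmetric] by (simp add: mfps_nth_generating_function)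
      from poly_two_valued_constant[OF this]
      have "mfps_nth ?f (u + t *s b i) = mfps_nth ?f (u + 0 *s b i)" unfolding q by simp
      then show ?thesis by (simp add: mfps_nth_generating_function split: if_splits)
    qed
    have "c + lin_comb I b n \<in> S \<longleftrightarrow> c \<in> S" for n
    proof -
      have "c + lin_comb J b n \<in> S \<longleftrightarrow> c \<in> S" if "J \<subseteq> I" for J
        using finite[of J] that
      proof (induction J)
        case empty
        then show ?case by (simp add: lin_comb_def)
      next
        case (insert i J)
        have "c + lin_comb J b n \<in> G"
          unfolding Geq lin_comb_subset[OF finite, of J I b n] using insert.prems
          by (simp add: lin_comb_subset[of I J] lin_set_memI)
        moreover have "c + lin_comb (insert i J) b n = c + lin_comb J b n + n i *s b i"
          using insert.hyps by (simp add: lin_comb_def add_ac)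
        ultimately show ?case using ray[of "c + lin_comb J b n" i "n i"] insert by simp
      qed
      then show ?thesis by blast
    qed
    then show "homogeneous S G" unfolding homogeneous_def Geq lin_set_def by blast
  qed
  have "S = \<Union> {G \<in> \<F>. G \<subseteq> S}" using \<F>(1) hom by (rule homogeneous_partition_Union)
  moreover have "presburger_set (\<Union> {G \<in> \<F>. G \<subseteq> S})"
    using \<F>(1) pres by (intro presburger_set_Union) (auto simp: partition_into_free_def)
  ultimately show ?thesis by simp
qed

theorem theorem1p5:
  fixes S :: "(nat ^ 'd::finite) set"
  shows "(presburger_set S \<longleftrightarrow> finite_union_of_pieces S) \<and>
         (finite_union_of_pieces S \<longleftrightarrow> rational_gf (generating_function S))"
  using qf_set_imp_finite_union_of_pieces(1)[OF presburger_imp_qf_set]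
    finite_union_of_pieces_imp_presburger presburger_imp_rational_gf rational_gf_imp_presburger
  by blast

end
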